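(* Let $f\in L^1(\mathbf{R}^2)$ be real-valued, let $x\in\mathbf{R}^2$, and suppose that $f$ is piecewise smooth of class $C^2$ with respect to $x$. (i) If the spherical mean value $r\mapsto\bar f_x(r)$ is continuous (that is, all jumps $\delta\bar f_x(a_i)$ vanish), then $$f_M(x)-\bar f_x(0+0)=O(1/M),\qquad M\to\infty.$$ (ii) Otherwise (that is, if $\delta\bar f_x(a_i)\neq0$ for some $i$), $$-\infty<\liminf_{M\to\infty}\sqrt{M}\,[f_M(x)-\bar f_x(0+0)]<\limsup_{M\to\infty}\sqrt{M}\,[f_M(x)-\bar f_x(0+0)]<\infty.$$
   Context: For $f\in L^1(\mathbf{R}^2)$ the Fourier transform is $$\hat f(\xi_1,\xi_2)=\frac{1}{(2\pi)^2}\int_{\mathbf{R}^2}f(x_1,x_2)e^{-i(\xi_1x_1+\xi_2x_2)}\,dx_1dx_2,$$ and for real $M>0$ the spherical partial sum is $$f_M(x_1,x_2)=\int_{\xi_1^2+\xi_2^2\le M^2}\hat f(\xi_1,\xi_2)e^{i(\xi_1x_1+\xi_2x_2)}\,d\xi_1d\xi_2.$$ The spherical mean value of $f$ with respect to $x=(x_1,x_2)$ is $$\bar f_x(r)=\frac{1}{2\pi}\int_0^{2\pi}f(x_1+r\cos\theta,\,x_2+r\sin\theta)\,d\theta,\qquad r>0.$$ The function $f$ is called piecewise smooth of class $C^k$ with respect to $x$ if the map $r\mapsto\bar f_x(r)$ is piecewise $C^k$ and there is $r(x)<\infty$ such that $\bar f_x(r)=0$ for $r\ge r(x)$. Piecewise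 $C^k$ means that there are finitely many points $0<a_1<\dots<a_K$ such that $\bar f_x$ is $C^k$ on each of the open intervals into which they divide $(0,\infty)$, and $\bar f_x$ and its derivatives up to order $k$ have finite left and right limits at each $a_i$ and finite right limits at $0$. The left and right limits agree at every point other than the $a_i$. The jumps are $\delta\bar f_x(a_i):=\bar f_x(a_i+0)-\bar f_x(a_i-0)$, where $a_i\pm0$ denote right and left limits. $\bar f_x(0+0)$ denotes the right limit of $\bar f_x$ at $0$. *)

theory Defs
  imports "HOL-Analysis.Analysis" "HOL-Library.Landau_Symbols"
begin

text \<open>
  Membership in \<open>L\<^sup>1(\<real>\<^sup>2)\<close> is \<open>integrable lebesgue f\<close>, so that \<open>f\<close> need not be Borel; hence the
  integrals involving \<open>f\<close> itself are taken over \<^const>\<open>lebesgue\<close>. The Fourier transform is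
  continuous, so \<^const>\<open>lborel\<close> suffices for the partial sums.
\<close>

definition fourier_transform_2d :: "(real \<times> real \<Rightarrow> real) \<Rightarrow> real \<times> real \<Rightarrow> complex" where
  "fourier_transform_2d f = (\<lambda>(\<xi>1, \<xi>2).
     1 / complex_of_real ((2 * pi)^2) *
     (LINT (x1, x2)|lebesgue. complex_of_real (f (x1, x2)) *
        exp (- (\<i> * complex_of_real (\<xi>1 * x1 + \<xi>2 * x2)))))"

definition spherical_partial_sum ::
    "(real \<times> real \<Rightarrow> real) \<Rightarrow> real \<Rightarrow> real \<times> real \<Rightarrow> complex" where
  "spherical_partial_sum f M = (\<lambda>(x1, x2).
     (LINT (\<xi>1, \<xi>2):{(\<xi>1, \<xi>2). \<xi>1^2 + \<xi>2^2 \<le> M^2}|lborel.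
        fourier_transform_2d f (\<xi>1, \<xi>2) *
        exp (\<i> * complex_of_real (\<xi>1 * x1 + \<xi>2 * x2))))"

definition spherical_mean :: "(real \<times> real \<Rightarrow> real) \<Rightarrow> real \<times> real \<Rightarrow> real \<Rightarrow> real" where
  "spherical_mean f = (\<lambda>(x1, x2) r.
     1 / (2 * pi) *
     (LINT \<theta>:{0..2 * pi}|lebesgue. f (x1 + r * cos \<theta>, x2 + r * sin \<theta>)))"

text \<open>The integral defining the spherical mean exists (otherwise its value above is a dummy 0).\<close>

definition spherical_mean_exists ::
    "(real \<times> real \<Rightarrow> real) \<Rightarrow> real \<times> real \<Rightarrow> real \<Rightarrow> bool" where
  "spherical_mean_exists f = (\<lambda>(x1, x2) r.
     set_integrable lebesgue {0..2 * pi} (\<lambda>\<theta>. f (x1 + r * cos \<theta>, x2 + r * sin \<theta>)))"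

text \<open>
  Iterated \<^const>\<open>deriv\<close> is meaningful here because \<open>S\<close> is required to be open: the \<open>j\<close>-th
  derivative at a point of \<open>S\<close> only depends on \<open>g\<close> near that point.
\<close>

definition Ck_on :: "nat \<Rightarrow> (real \<Rightarrow> real) \<Rightarrow> real set \<Rightarrow> bool" where
  "Ck_on k g S \<longleftrightarrow> open S \<and>
     (\<forall>j<k. (deriv ^^ j) g differentiable_on S) \<and>
     (\<forall>j\<le>k. continuous_on S ((deriv ^^ j) g))"

text \<open>
  \<open>A\<close> is the set of break points \<open>a\<^sub>1 < \<dots> < a\<^sub>K\<close>; the open intervals into which they divide
  \<open>(0,\<infinity>)\<close> are the components of \<open>{0<..} - A\<close>. The values of \<open>g\<close> at the break points play no role.
\<close>

definition piecewise_Ck :: "nat \<Rightarrow> real set \<Rightarrow> (real \<Rightarrow> real) \<Rightarrow> bool" where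
  "piecewise_Ck k A g \<longleftrightarrow>
     finite A \<and> A \<subseteq> {0<..} \<and>
     Ck_on k g ({0<..} - A) \<and>
     (\<forall>a\<in>A. \<forall>j\<le>k. \<exists>l. ((deriv ^^ j) g \<longlongrightarrow> l) (at_left a)) \<and>
     (\<forall>a\<in>insert 0 A. \<forall>j\<le>k. \<exists>l. ((deriv ^^ j) g \<longlongrightarrow> l) (at_right a))"

definition piecewise_smooth_wrt ::
    "nat \<Rightarrow> real set \<Rightarrow> (real \<times> real \<Rightarrow> real) \<Rightarrow> real \<times> real \<Rightarrow> bool" where
  "piecewise_smooth_wrt k A f x \<longleftrightarrow>
     (\<forall>r\<in>{0<..} - A. spherical_mean_exists f x r) \<and>
     piecewise_Ck k A (spherical_mean f x) \<and>
     (\<exists>R. \<forall>r\<ge>R. spherical_mean f x r = 0)"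

definition right_limit :: "(real \<Rightarrow> real) \<Rightarrow> real \<Rightarrow> real" where
  "right_limit g a = Lim (at_right a) g"

definition left_limit :: "(real \<Rightarrow> real) \<Rightarrow> real \<Rightarrow> real" where
  "left_limit g a = Lim (at_left a) g"

definition jump :: "(real \<Rightarrow> real) \<Rightarrow> real \<Rightarrow> real" where
  "jump g a = right_limit g a - left_limit g a"

text \<open>
  For real-valued \<open>f\<close> the partial sums are real, so nothing is lost by taking \<^const>\<open>Re\<close> where an
  order on the values is needed.
\<close>

lemma fourier_transform_2d_uminus:
  "fourier_transform_2d f (- \<xi>) = cnj (fourier_transform_2d f \<xi>)"
proof -
  obtain a b where \<xi>: "\<xi> = (a, b)" by (cases \<xi>)
  define g where "g = (\<lambda>p. complex_of_real (f p) *
    exp (- (\<i> * complex_of_real (a * fst p + b * snd p))))"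
  have "cnj (integral\<^sup>L lebesgue g) = (LINT p|lebesgue. cnj (g p))"
    by (rule Bochner_Integration.integral_cnj[symmetric])
  then show ?thesis
    unfolding \<xi> fourier_transform_2d_def g_def
    by (simp add: case_prod_unfold exp_cnj algebra_simps)
qed

lemma spherical_partial_sum_real: "spherical_partial_sum f M x \<in> \<real>"
proof -
  obtain x1 x2 where x: "x = (x1, x2)" by (cases x)
  define h :: "real \<times> real \<Rightarrow> complex" where
    "h = (\<lambda>\<xi>. indicator {(\<xi>1, \<xi>2). \<xi>1^2 + \<xi>2^2 \<le> M^2} \<xi> *\<^sub>R
       (fourier_transform_2d f \<xi> * exp (\<i> * complex_of_real (fst \<xi> * x1 + snd \<xi> * x2))))"
  have eq: "spherical_partial_sum f M x = integral\<^sup>L lborel h"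
    by (simp add: x spherical_partial_sum_def set_lebesgue_integral_def h_def case_prod_unfold)
  have h_uminus: "h (- \<xi>) = cnj (h \<xi>)" for \<xi>
    by (auto simp: h_def fourier_transform_2d_uminus indicator_def exp_cnj algebra_simps
        split: prod.splits)
  have "cnj (integral\<^sup>L lborel h) = integral\<^sup>L lborel h"
  proof (cases "integrable lborel h")
    case True
    have "integral\<^sup>L lborel h =
      integral\<^sup>L (density (distr lborel borel (\<lambda>\<xi>. 0 + (- 1) *\<^sub>R \<xi>)) (\<lambda>_. 1)) h"
      using lborel_affine[of "- 1" "0 :: real \<times> real"] by simp
    also have "\<dots> = (LINT \<xi>|lborel. h (- \<xi>))"
      using True by (simp add: density_1 integral_distr borel_measurable_integrable)
    also have "\<dots> = cnj (integral\<^sup>L lborel h)"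
      by (simp add: h_uminus)
    finally show ?thesis by simp
  qed (simp add: not_integrable_integral_eq)
  then show ?thesis
    by (simp add: eq Reals_cnj_iff)
qed

end

theory Submission
  imports Defs
begin

text \<open>
  Write \<open>g\<close> for the spherical mean at \<open>x\<close>. By Fubini and polar coordinates
  \<open>f\<^sub>M(x) = \<integral>\<^sub>0\<^sup>\<infinity> g(r) M J\<^sub>1(M r) dr\<close>. Since \<open>M J\<^sub>1(M r)\<close> is the derivative of \<open>- J\<^sub>0(M r)\<close>, integrating by
  parts over the pieces of \<open>g\<close> gives
  \<open>f\<^sub>M(x) - g(0+) = (\<Sum>a. \<delta>g(a) J\<^sub>0(M a)) + \<integral> g'(r) J\<^sub>0(M r) dr\<close>,
  and a second integration by parts bounds the last integral by \<open>O(1/M)\<close>, because the primitive of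
  \<open>J\<^sub>0\<close> is bounded. As \<open>\<surd>u J\<^sub>0(u) = Re (c e\<^sup>i\<^sup>u) + O(1/u)\<close> with \<open>c \<noteq> 0\<close>, the expression in (ii) is, up to
  \<open>o(1)\<close>, a trigonometric sum \<open>Re (\<Sum>a. d\<^sub>a e\<^sup>i\<^sup>a\<^sup>M)\<close>. It is bounded, and it cannot converge unless all
  \<open>d\<^sub>a\<close> vanish.
\<close>

text \<open>The radial integral carries no weight because the cosine transform of the disc of radius
  \<open>M\<close> is 2 pi M J_1(M r) / r, whose 1/r cancels the polar Jacobian; the two angular
  factors 2 pi cancel the normalisation of the Fourier transform. The term g(0+) is the boundary
  term at 0, where J_0 equals 1. A single integration by parts does not suffice: J_0(u) decays only
  like u^(-1/2), so estimating the integral of g'(r) J_0(M r) by absolute values gives O(M^(-1/2)),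
  the size of the jump terms themselves. The gain to 1/M must come from cancellation, hence the
  bounded primitive and the use of g''. A second obstacle is measurability. \<open>f\<close> is only
  Lebesgue measurable and circles are null sets, so a Borel representative of \<open>f\<close> can
  be compared with \<open>f\<close> only on almost every circle. That is enough because the means
  enter only under an integral over the radius.\<close>

section \<open>Polar coordinates\<close>

lemma cot_eq_tan: "cot \<theta> = tan (pi / 2 - \<theta>)" for \<theta> :: real
  by (simp add: cot_def tan_def sin_diff cos_diff)

lemma borel_measurable_cot [measurable]: "(cot :: real \<Rightarrow> real) \<in> borel_measurable borel"
  unfolding cot_def[abs_def] by measurable

text \<open>\<open>cot\<close> maps (0, pi) bijectively onto the line and the density is the
  absolute value of its derivative. It suffices to compare both measures on boxes, where
  \<open>- cot\<close> is a primitive of the density.\<close>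

lemma lborel_eq_distr_cot:
  "lborel = distr (density lborel (\<lambda>\<theta>. indicator {0<..<pi} \<theta> * ennreal (inverse ((sin \<theta>)\<^sup>2)))) borel cot"
proof (rule lborel_eqI)
  fix l u :: real assume "\<And>b. b \<in> Basis \<Longrightarrow> l \<bullet> b \<le> u \<bullet> b"
  then have lu: "l \<le> u" by simp
  \<comment> \<open>Inverse cotangents of the endpoints; they change order because
    \<open>cot\<close> is decreasing on (0, pi).\<close>
  define \<alpha> \<beta> where "\<alpha> = pi / 2 - arctan u" and "\<beta> = pi / 2 - arctan l"
  have \<alpha>\<beta>: "0 < \<alpha>" "\<alpha> \<le> \<beta>" "\<beta> < pi"
    using arctan_bounded[of u] arctan_bounded[of l] lu by (auto simp: \<alpha>_def \<beta>_def arctan_le_iff)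
  have iff: "cot \<theta> \<in> box l u \<longleftrightarrow> \<theta> \<in> {\<alpha><..<\<beta>}" if "\<theta> \<in> {0<..<pi}" for \<theta>
  proof -
    have "l < tan (pi / 2 - \<theta>) \<longleftrightarrow> arctan l < pi / 2 - \<theta>"
      using that by (subst arctan_less_iff[symmetric], subst arctan_tan) auto
    moreover have "tan (pi / 2 - \<theta>) < u \<longleftrightarrow> pi / 2 - \<theta> < arctan u"
      using that by (subst arctan_less_iff[symmetric], subst arctan_tan) auto
    ultimately show ?thesis
      by (auto simp: cot_eq_tan \<alpha>_def \<beta>_def box_real)
  qed
  have [measurable]: "cot -` {l<..<u} \<in> sets borel"
    using measurable_sets[OF borel_measurable_cot, of "{l<..<u}"] by simp
  have "emeasure (distr (density lborel (\<lambda>\<theta>. indicator {0<..<pi} \<theta> * ennreal (inverse ((sin \<theta>)\<^sup>2)))) borel cot) (box l u)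
    = (\<integral>\<^sup>+\<theta>. indicator {0<..<pi} \<theta> * ennreal (inverse ((sin \<theta>)\<^sup>2)) * indicator (cot -` box l u) \<theta> \<partial>lborel)"
    by (simp add: emeasure_distr emeasure_density)
  \<comment> \<open>Adding the endpoints changes only a null set and gives the closed interval on
    which the fundamental theorem is applied.\<close>
  also have "\<dots> = (\<integral>\<^sup>+\<theta>. ennreal (inverse ((sin \<theta>)\<^sup>2)) * indicator {\<alpha>..\<beta>} \<theta> \<partial>lborel)"
  proof (rule nn_integral_cong_AE)
    show "AE \<theta> in lborel. indicator {0<..<pi} \<theta> * ennreal (inverse ((sin \<theta>)\<^sup>2)) * indicator (cot -` box l u) \<theta>
        = ennreal (inverse ((sin \<theta>)\<^sup>2)) * indicator {\<alpha>..\<beta>} \<theta>"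
      using AE_lborel_singleton[of \<alpha>] AE_lborel_singleton[of \<beta>]
    proof eventually_elim
      case (elim \<theta>)
      then show ?case
        using iff[of \<theta>] \<alpha>\<beta> by (auto simp: indicator_def)
    qed
  qed
  also have "\<dots> = ennreal (- cot \<beta> - (- cot \<alpha>))"
  proof (rule nn_integral_FTC_Icc)
    fix \<theta> assume "\<theta> \<in> {\<alpha>..\<beta>}"
    then have "sin \<theta> > 0" using \<alpha>\<beta> by (intro sin_gt_zero) auto
    then show "((\<lambda>\<theta>. - cot \<theta>) has_real_derivative inverse ((sin \<theta>)\<^sup>2)) (at \<theta>)"
      using DERIV_minus[OF DERIV_cot[of \<theta>]] by simp
  qed (use \<alpha>\<beta> in auto)
  also have "- cot \<beta> - (- cot \<alpha>) = u - l"
    by (simp add: cot_eq_tan \<alpha>_def \<beta>_def tan_arctan)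
  finally show "emeasure (distr (density lborel (\<lambda>\<theta>. indicator {0<..<pi} \<theta> * ennreal (inverse ((sin \<theta>)\<^sup>2)))) borel cot) (box l u)
    = (\<Prod>b\<in>Basis. (u - l) \<bullet> b)" by simp
qed simp

text \<open>
  The substitution \<open>x = y cot \<theta>\<close> at fixed \<open>y\<close>, followed by \<open>y = r sin \<theta>\<close> at fixed \<open>\<theta>\<close>, needs only
  one-dimensional changes of variables.
\<close>

lemma nn_integral_polar_upper:
  fixes g :: "real \<times> real \<Rightarrow> ennreal"
  assumes [measurable]: "g \<in> borel_measurable borel"
  shows "(\<integral>\<^sup>+y. indicator {0<..} y * (\<integral>\<^sup>+x. g (x, y) \<partial>lborel) \<partial>lborel) =
    (\<integral>\<^sup>+\<theta>. indicator {0<..<pi} \<theta> * (\<integral>\<^sup>+r. indicator {0<..} r * ennreal r * g (r * cos \<theta>, r * sin \<theta>) \<partial>lborel) \<partial>lborel)"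
proof -
  \<comment> \<open>The factor y / sin^2 is the Jacobian of x = y cot \<theta> at fixed
    \<open>y\<close>.\<close>
  define w where "w y \<theta> = indicator {0<..} y * indicator {0<..<pi} \<theta> * ennreal (y * inverse ((sin \<theta>)\<^sup>2)) * g (y * cot \<theta>, y)" for y \<theta>
  have [measurable]: "case_prod w \<in> borel_measurable (lborel \<Otimes>\<^sub>M lborel)"
    unfolding w_def by measurable
  have "indicator {0<..} y * (\<integral>\<^sup>+x. g (x, y) \<partial>lborel) = (\<integral>\<^sup>+\<theta>. w y \<theta> \<partial>lborel)" for y
  proof (cases "y > 0")
    case True
    have "(\<integral>\<^sup>+x. g (x, y) \<partial>lborel) = ennreal y * (\<integral>\<^sup>+t. g (y * t, y) \<partial>lborel)"
      using True by (subst nn_integral_real_affine[where c = y and t = 0]) auto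
    also have "(\<integral>\<^sup>+t. g (y * t, y) \<partial>lborel) =
        (\<integral>\<^sup>+\<theta>. indicator {0<..<pi} \<theta> * ennreal (inverse ((sin \<theta>)\<^sup>2)) * g (y * cot \<theta>, y) \<partial>lborel)"
      by (subst lborel_eq_distr_cot) (simp add: nn_integral_distr nn_integral_density)
    also have "ennreal y * \<dots> = (\<integral>\<^sup>+\<theta>. w y \<theta> \<partial>lborel)"
      using True by (subst nn_integral_cmult[symmetric]) (auto simp: w_def ennreal_mult mult_ac intro!: nn_integral_cong)
    finally show ?thesis using True by simp
  qed (simp add: w_def)
  then have "(\<integral>\<^sup>+y. indicator {0<..} y * (\<integral>\<^sup>+x. g (x, y) \<partial>lborel) \<partial>lborel) = (\<integral>\<^sup>+y. (\<integral>\<^sup>+\<theta>. w y \<theta> \<partial>lborel) \<partial>lborel)"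
    by simp
  also have "\<dots> = (\<integral>\<^sup>+\<theta>. (\<integral>\<^sup>+y. w y \<theta> \<partial>lborel) \<partial>lborel)"
    by (rule lborel_pair.Fubini'[symmetric]) (simp add: case_prod_unfold measurable_split_conv)
  also have "\<dots> = (\<integral>\<^sup>+\<theta>. indicator {0<..<pi} \<theta> * (\<integral>\<^sup>+r. indicator {0<..} r * ennreal r * g (r * cos \<theta>, r * sin \<theta>) \<partial>lborel) \<partial>lborel)"
  proof (rule nn_integral_cong)
    fix \<theta>
    show "(\<integral>\<^sup>+y. w y \<theta> \<partial>lborel) =
      indicator {0<..<pi} \<theta> * (\<integral>\<^sup>+r. indicator {0<..} r * ennreal r * g (r * cos \<theta>, r * sin \<theta>) \<partial>lborel)"
    proof (cases "\<theta> \<in> {0<..<pi}")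
      case True
      then have s: "sin \<theta> > 0" by (intro sin_gt_zero) auto
      have [measurable]: "(\<lambda>y. w y \<theta>) \<in> borel_measurable borel"
        unfolding w_def by measurable
      have "(\<integral>\<^sup>+y. w y \<theta> \<partial>lborel) = ennreal (sin \<theta>) * (\<integral>\<^sup>+r. w (sin \<theta> * r) \<theta> \<partial>lborel)"
        using s by (subst nn_integral_real_affine[where c = "sin \<theta>" and t = 0]) auto
      also have "\<dots> = (\<integral>\<^sup>+r. ennreal (sin \<theta>) * w (sin \<theta> * r) \<theta> \<partial>lborel)"
        by (rule nn_integral_cmult[symmetric]) simp
      also have "\<dots> = (\<integral>\<^sup>+r. indicator {0<..} r * ennreal r * g (r * cos \<theta>, r * sin \<theta>) \<partial>lborel)"
      proof (rule nn_integral_cong)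
        fix r :: real
        show "ennreal (sin \<theta>) * w (sin \<theta> * r) \<theta> = indicator {0<..} r * ennreal r * g (r * cos \<theta>, r * sin \<theta>)"
        proof (cases "r > 0")
          case r: True
          \<comment> \<open>At y = r sin \<theta> the weight of \<open>w\<close> is r / sin
            \<theta>; the Jacobian sin \<theta> of this second substitution leaves exactly
            \<open>r\<close>.\<close>
          have "ennreal (sin \<theta>) * ennreal (sin \<theta> * r * inverse ((sin \<theta>)\<^sup>2)) = ennreal r"
            using s r by (subst ennreal_mult[symmetric]) (auto simp: power2_eq_square field_simps)
          moreover have "w (sin \<theta> * r) \<theta> = ennreal (sin \<theta> * r * inverse ((sin \<theta>)\<^sup>2)) * g (sin \<theta> * r * cot \<theta>, sin \<theta> * r)"
            using r s True by (simp add: w_def)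
          moreover have "sin \<theta> * r * cot \<theta> = r * cos \<theta>" "sin \<theta> * r = r * sin \<theta>"
            using s by (simp_all add: cot_def)
          ultimately show ?thesis using r by (simp only: mult.assoc[symmetric]) simp
        qed (use s in \<open>simp add: w_def zero_less_mult_iff\<close>)
      qed
      finally show ?thesis using True by simp
    qed (simp add: w_def)
  qed
  finally show ?thesis .
qed

text \<open>The lower half-plane is the image of the upper one under z -> -z, which shifts the angle
  by pi. The axis y = 0 and the angles 0, pi, 2 pi are null.\<close>

lemma nn_integral_polar:
  fixes g :: "real \<times> real \<Rightarrow> ennreal"
  assumes [measurable]: "g \<in> borel_measurable borel"
  shows "(\<integral>\<^sup>+z. g z \<partial>lborel) =
    (\<integral>\<^sup>+\<theta>. indicator {0..2*pi} \<theta> * (\<integral>\<^sup>+r. indicator {0<..} r * ennreal r * g (r * cos \<theta>, r * sin \<theta>) \<partial>lborel) \<partial>lborel)"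
proof -
  define H where "H y = (\<integral>\<^sup>+x. g (x, y) \<partial>lborel)" for y
  define K where "K \<theta> = (\<integral>\<^sup>+r. indicator {0<..} r * ennreal r * g (r * cos \<theta>, r * sin \<theta>) \<partial>lborel)" for \<theta>
  have "(\<lambda>z::real \<times> real. (- fst z, - snd z)) \<in> borel_measurable borel"
    by (intro borel_measurable_continuous_onI continuous_intros)
  from measurable_compose[OF this assms]
  have [measurable]: "(\<lambda>z. g (- fst z, - snd z)) \<in> borel_measurable borel" .
  have [measurable]: "H \<in> borel_measurable borel"
    unfolding H_def[abs_def] by measurable
  have "(\<lambda>p::real \<times> real. (snd p * cos (fst p), snd p * sin (fst p))) \<in> borel_measurable borel"
    by (intro borel_measurable_continuous_onI continuous_intros)
  from measurable_compose[OF this assms]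
  have "(\<lambda>(\<theta>, r). g (r * cos \<theta>, r * sin \<theta>)) \<in> borel_measurable (borel \<Otimes>\<^sub>M borel)"
    by (simp add: borel_prod case_prod_unfold)
  then have K: "(\<lambda>(\<theta>, r). indicator {0<..} r * ennreal r * g (r * cos \<theta>, r * sin \<theta>)) \<in> borel_measurable (borel \<Otimes>\<^sub>M lborel)"
    unfolding case_prod_unfold by measurable
  have [measurable]: "K \<in> borel_measurable borel"
    unfolding K_def[abs_def] by (rule lborel.borel_measurable_nn_integral[OF K])
  have "(\<integral>\<^sup>+z. g z \<partial>lborel) = (\<integral>\<^sup>+y. H y \<partial>lborel)"
    unfolding H_def by (subst lborel_pair.nn_integral_snd) (simp_all add: lborel_prod)
  also have "\<dots> = (\<integral>\<^sup>+y. indicator {0<..} y * H y + indicator {..<0} y * H y \<partial>lborel)"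
  proof (rule nn_integral_cong_AE)
    show "AE y in lborel. H y = indicator {0<..} y * H y + indicator {..<0} y * H y"
      using AE_lborel_singleton[of 0] by eventually_elim (auto simp: indicator_def)
  qed
  also have "\<dots> = (\<integral>\<^sup>+y. indicator {0<..} y * H y \<partial>lborel) + (\<integral>\<^sup>+y. indicator {..<0} y * H y \<partial>lborel)"
    by (rule nn_integral_add) auto
  also have "(\<integral>\<^sup>+y. indicator {0<..} y * H y \<partial>lborel) = (\<integral>\<^sup>+\<theta>. indicator {0<..<pi} \<theta> * K \<theta> \<partial>lborel)"
    unfolding H_def K_def by (rule nn_integral_polar_upper) simp
  also have "(\<integral>\<^sup>+y. indicator {..<0} y * H y \<partial>lborel) = (\<integral>\<^sup>+y. indicator {..<0} (- y) * H (- y) \<partial>lborel)"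
    by (subst nn_integral_real_affine[where c = "-1" and t = 0]) auto
  also have "\<dots> = (\<integral>\<^sup>+y. indicator {0<..} y * (\<integral>\<^sup>+x. g (- x, - y) \<partial>lborel) \<partial>lborel)"
  proof (rule nn_integral_cong)
    fix y :: real
    have "H (- y) = (\<integral>\<^sup>+x. g (- x, - y) \<partial>lborel)"
      unfolding H_def by (subst nn_integral_real_affine[where c = "-1" and t = 0]) auto
    then show "indicator {..<0} (- y) * H (- y) = indicator {0<..} y * (\<integral>\<^sup>+x. g (- x, - y) \<partial>lborel)"
      by (auto simp: indicator_def)
  qed
  also have "\<dots> = (\<integral>\<^sup>+\<theta>. indicator {0<..<pi} \<theta> * K (pi + \<theta>) \<partial>lborel)"
    unfolding K_def by (subst nn_integral_polar_upper[where g = "\<lambda>z. g (- fst z, - snd z)", simplified])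
      (simp_all add: sin_add cos_add)
  also have "\<dots> = (\<integral>\<^sup>+\<theta>. indicator {pi<..<2*pi} \<theta> * K \<theta> \<partial>lborel)"
    by (subst (2) nn_integral_real_affine[where c = 1 and t = pi]) (auto simp: indicator_def intro!: nn_integral_cong)
  also have "(\<integral>\<^sup>+\<theta>. indicator {0<..<pi} \<theta> * K \<theta> \<partial>lborel) + \<dots>
      = (\<integral>\<^sup>+\<theta>. indicator {0<..<pi} \<theta> * K \<theta> + indicator {pi<..<2*pi} \<theta> * K \<theta> \<partial>lborel)"
    by (rule nn_integral_add[symmetric]) auto
  also have "\<dots> = (\<integral>\<^sup>+\<theta>. indicator {0..2*pi} \<theta> * K \<theta> \<partial>lborel)"
  proof (rule nn_integral_cong_AE)
    show "AE \<theta> in lborel. indicator {0<..<pi} \<theta> * K \<theta> + indicator {pi<..<2*pi} \<theta> * K \<theta> = indicator {0..2*pi} \<theta> * K \<theta>"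
      using AE_lborel_singleton[of 0] AE_lborel_singleton[of pi] AE_lborel_singleton[of "2*pi"]
      by eventually_elim (auto simp: indicator_def)
  qed
  finally show ?thesis unfolding K_def .
qed

text \<open>As an equality of measures, the formula transports integrability, signed integrals and
  almost-everywhere statements at once.\<close>

lemma lborel_eq_distr_polar:
  "lborel = distr (density (lborel \<Otimes>\<^sub>M lborel) (\<lambda>(r, \<theta>). ennreal (indicator ({0<..} \<times> {0..2*pi}) (r, \<theta>) * r)))
     borel (\<lambda>(r, \<theta>). (r * cos \<theta>, r * sin \<theta>))" (is "_ = distr (density _ ?w) _ ?P")
proof (rule measure_eqI)
  have [measurable]: "?P \<in> borel_measurable (lborel \<Otimes>\<^sub>M lborel)" "?w \<in> borel_measurable (lborel \<Otimes>\<^sub>M lborel)"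
    by measurable
  fix S :: "(real \<times> real) set" assume "S \<in> sets lborel"
  then have [measurable]: "S \<in> sets borel" by simp
  have "emeasure (distr (density (lborel \<Otimes>\<^sub>M lborel) ?w) borel ?P) S
      = (\<integral>\<^sup>+z. indicator S z \<partial>distr (density (lborel \<Otimes>\<^sub>M lborel) ?w) borel ?P)"
    by simp
  also have "\<dots> = (\<integral>\<^sup>+p. ?w p * indicator S (?P p) \<partial>(lborel \<Otimes>\<^sub>M lborel))"
    by (subst nn_integral_distr) (simp_all add: nn_integral_density)
  also have "\<dots> = (\<integral>\<^sup>+\<theta>. (\<integral>\<^sup>+r. ?w (r, \<theta>) * indicator S (?P (r, \<theta>)) \<partial>lborel) \<partial>lborel)"
    by (rule lborel_pair.nn_integral_snd[symmetric]) simp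
  also have "\<dots> = (\<integral>\<^sup>+\<theta>. indicator {0..2*pi} \<theta> * (\<integral>\<^sup>+r. indicator {0<..} r * ennreal r * indicator S (r * cos \<theta>, r * sin \<theta>) \<partial>lborel) \<partial>lborel)"
    by (intro nn_integral_cong, subst nn_integral_cmult[symmetric]) (auto intro!: nn_integral_cong simp: indicator_def)
  also have "\<dots> = (\<integral>\<^sup>+z. indicator S z \<partial>lborel)"
    by (rule nn_integral_polar[symmetric]) simp
  finally show "emeasure lborel S = emeasure (distr (density (lborel \<Otimes>\<^sub>M lborel) ?w) borel ?P) S"
    by simp
qed simp

section \<open>Bessel functions\<close>

text \<open>Integral representations of J_0 and of J_1 = -J_0'. The first is the angular average of
  plane waves, the form in which J_0 enters \<open>disc_kernel\<close>; derivatives and bounds are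
  read off under the integral sign.\<close>

definition bessel0 :: "real \<Rightarrow> real" where
  "bessel0 u = integral {0..2*pi} (\<lambda>\<theta>. cos (u * cos \<theta>)) / (2*pi)"

definition bessel1 :: "real \<Rightarrow> real" where
  "bessel1 u = integral {0..2*pi} (\<lambda>\<theta>. sin (u * cos \<theta>) * cos \<theta>) / (2*pi)"

lemma bessel0_0: "bessel0 0 = 1"
  by (simp add: bessel0_def)

lemma bessel0_deriv: "(bessel0 has_real_derivative - bessel1 u) (at u)"
proof -
  have "((\<lambda>u. integral (cbox 0 (2*pi)) (\<lambda>\<theta>. cos (u * cos \<theta>))) has_real_derivative
      integral (cbox 0 (2*pi)) (\<lambda>\<theta>. - sin (u * cos \<theta>) * cos \<theta>)) (at u)"
    by (rule leibniz_rule_field_derivative[where U = UNIV])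
       (auto intro!: derivative_eq_intros continuous_intros integrable_continuous_real simp: case_prod_unfold)
  from DERIV_cdivide[OF this, of "2*pi"] show ?thesis
    by (simp add: bessel0_def[abs_def] bessel1_def)
qed

text \<open>Together with \<open>bessel0_deriv\<close> this is Bessel's equation of order 0.
  Differentiating under the integral produces cos^2 = 1 - sin^2, and the sin^2 part is J_1(u) / u by
  an integration by parts in \<theta>.\<close>

lemma bessel1_deriv:
  assumes "u \<noteq> 0"
  shows "(bessel1 has_real_derivative bessel0 u - bessel1 u / u) (at u)"
proof -
  define F where "F = integral {0..2*pi} (\<lambda>\<theta>. cos (u * cos \<theta>) * (sin \<theta>)\<^sup>2)"
  have d: "((\<lambda>u. integral (cbox 0 (2*pi)) (\<lambda>\<theta>. sin (u * cos \<theta>) * cos \<theta>)) has_real_derivative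
      integral (cbox 0 (2*pi)) (\<lambda>\<theta>. cos (u * cos \<theta>) * cos \<theta> * cos \<theta>)) (at u)"
    by (rule leibniz_rule_field_derivative[where U = UNIV])
       (auto intro!: derivative_eq_intros continuous_intros integrable_continuous_real simp: case_prod_unfold)
  \<comment> \<open>The integrand is the derivative of sin (u cos \<theta>) sin \<theta>, which
    vanishes at both ends.\<close>
  have "((\<lambda>\<theta>. sin (u * cos \<theta>) * cos \<theta> - u * (cos (u * cos \<theta>) * (sin \<theta>)\<^sup>2)) has_integral
      sin (u * cos (2*pi)) * sin (2*pi) - sin (u * cos 0) * sin 0) {0..2*pi}"
    by (rule fundamental_theorem_of_calculus)
       (auto intro!: derivative_eq_intros simp flip: has_real_derivative_iff_has_vector_derivative
          simp: power2_eq_square)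
  then have "integral {0..2*pi} (\<lambda>\<theta>. sin (u * cos \<theta>) * cos \<theta> - u * (cos (u * cos \<theta>) * (sin \<theta>)\<^sup>2)) = 0"
    by (simp add: integral_unique)
  then have F: "2 * pi * bessel1 u = u * F"
    by (subst (asm) Henstock_Kurzweil_Integration.integral_diff)
       (auto intro!: integrable_continuous_real continuous_intros simp: bessel1_def F_def)
  have "integral {0..2*pi} (\<lambda>\<theta>. cos (u * cos \<theta>) * cos \<theta> * cos \<theta>)
      = integral {0..2*pi} (\<lambda>\<theta>. cos (u * cos \<theta>) - cos (u * cos \<theta>) * (sin \<theta>)\<^sup>2)"
    by (rule Henstock_Kurzweil_Integration.integral_cong)
       (simp add: sin_squared_eq right_diff_distrib mult.assoc flip: power2_eq_square)
  also have "\<dots> = 2 * pi * bessel0 u - F"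
    unfolding F_def bessel0_def
    by (subst Henstock_Kurzweil_Integration.integral_diff)
       (auto intro!: integrable_continuous_real continuous_intros)
  also have "F = 2 * pi * (bessel1 u / u)"
    using F assms by (simp add: field_simps)
  finally have "integral {0..2*pi} (\<lambda>\<theta>. cos (u * cos \<theta>) * cos \<theta> * cos \<theta>) / (2*pi)
      = bessel0 u - bessel1 u / u"
    by (simp add: field_simps)
  with DERIV_cdivide[OF d, of "2*pi"] show ?thesis
    by (simp add: bessel1_def[abs_def])
qed

lemma bessel0_le_1: "\<bar>bessel0 u\<bar> \<le> 1"
proof -
  have "norm (integral {0..2*pi} (\<lambda>\<theta>. cos (u * cos \<theta>))) \<le> 1 * (2*pi - 0)"
    by (rule integral_bound) (auto intro!: continuous_intros)
  then show ?thesis by (simp add: bessel0_def field_simps)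
qed

lemma bessel1_le_1: "\<bar>bessel1 u\<bar> \<le> 1"
proof -
  have "norm (integral {0..2*pi} (\<lambda>\<theta>. sin (u * cos \<theta>) * cos \<theta>)) \<le> 1 * (2*pi - 0)"
    by (rule integral_bound) (auto intro!: continuous_intros mult_le_one simp: abs_mult)
  then show ?thesis by (simp add: bessel1_def field_simps)
qed

text \<open>One nonzero value of J_0 is what later shows that the leading amplitude at infinity is
  nonzero. The integrand cos (cos \<theta>) never falls below cos 1.\<close>

lemma bessel0_1_pos: "bessel0 1 > 0"
proof -
  have "integral {0..2*pi} (\<lambda>\<theta>. cos 1) \<le> integral {0..2*pi} (\<lambda>\<theta>. cos (1 * cos \<theta>))"
  proof (rule integral_le)
    fix \<theta> :: real
    have "cos 1 \<le> cos \<bar>cos \<theta>\<bar>" using pi_gt3 abs_cos_le_one[of \<theta>]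
      by (subst cos_mono_le_eq) (linarith | simp)+
    then show "cos 1 \<le> cos (1 * cos \<theta>)" by simp
  qed (auto intro!: integrable_continuous_real continuous_intros)
  moreover have "cos (1::real) > 0" using pi_gt3 by (intro cos_gt_zero) auto
  then have "0 < 2 * pi * cos (1::real)" by simp
  ultimately show ?thesis
    by (simp add: bessel0_def)
qed

lemma continuous_bessel0 [continuous_intros]: 
  "continuous_on S f \<Longrightarrow> continuous_on S (\<lambda>x. bessel0 (f x))"
  by (rule continuous_on_compose2[of UNIV bessel0])
     (auto intro: DERIV_isCont bessel0_deriv continuous_at_imp_continuous_on)

lemma continuous_bessel1 [continuous_intros]:
  assumes "continuous_on S f"
  shows "continuous_on S (\<lambda>x. bessel1 (f x))"
proof -
  have "continuous_on UNIV (\<lambda>u. integral (cbox 0 (2*pi)) (\<lambda>\<theta>. sin (u * cos \<theta>) * cos \<theta>))"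
    by (rule integral_continuous_on_param) (auto intro!: continuous_intros simp: case_prod_unfold)
  then have "continuous_on UNIV bessel1"
    unfolding bessel1_def[abs_def] by (intro continuous_intros) auto
  then show ?thesis using assms by (rule continuous_on_compose2) simp
qed

text \<open>J_0 is not absolutely integrable, so boundedness of the primitive rests on oscillation:
  J_0 = J_1' + J_1 / u with J_1 = -J_0', hence G - J_1 + J_0 / u has derivative -J_0 / u^2, which is
  integrable at infinity.\<close>

lemma integral_bessel0:
  obtains G C where "\<And>u. u \<ge> 0 \<Longrightarrow> (G has_real_derivative bessel0 u) (at u)"
    and "\<And>u. u \<ge> 0 \<Longrightarrow> \<bar>G u\<bar> \<le> C"
proof -
  \<comment> \<open>Starting at -1 makes 0 an interior point, so that the derivative there is
    two-sided.\<close>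
  define G where "G u = integral {-1..u} bessel0" for u
  have G: "(G has_real_derivative bessel0 u) (at u)" if "u \<ge> 0" for u
  proof -
    have "(G has_real_derivative bessel0 u) (at u within {-1..u+1})"
      unfolding G_def using that by (intro integral_has_real_derivative continuous_intros) auto
    then show ?thesis using that by (subst (asm) at_within_interior) auto
  qed
  \<comment> \<open>The 5 collects five terms of size at most 1: the increment of \<open>?H\<close>
    and the values of \<open>bessel1\<close> and \<open>bessel0 v / v\<close> at \<open>u\<close>
    and at 1.\<close>
  have bnd: "\<bar>G u\<bar> \<le> \<bar>G 1\<bar> + 5" if "u \<ge> 1" for u
  proof -
    let ?H = "\<lambda>u. G u - bessel1 u + bessel0 u / u"
    have H: "(?H has_real_derivative - bessel0 v / v\<^sup>2) (at v)" if "v \<ge> 1" for v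
      using that by (auto intro!: derivative_eq_intros G bessel0_deriv bessel1_deriv simp: power2_eq_square field_simps)
    have "norm (?H u - ?H 1) \<le> (- 1 / u) - (- 1 / 1)" if "u > 1"
    proof (rule differentiable_bound_general[OF that])
      show "continuous_on {1..u} ?H"
        by (intro continuous_at_imp_continuous_on ballI DERIV_isCont[OF H]) auto
      show "continuous_on {1..u} (\<lambda>x. - 1 / x)"
        by (auto intro!: continuous_intros)
      show "(?H has_vector_derivative - bessel0 x / x\<^sup>2) (at x)" if "1 < x" for x
        using H[of x] that by (simp flip: has_real_derivative_iff_has_vector_derivative)
      show "((\<lambda>x. - 1 / x) has_vector_derivative 1 / x\<^sup>2) (at x)" if "1 < x" for x
        using that by (auto intro!: derivative_eq_intros simp: power2_eq_square
            simp flip: has_real_derivative_iff_has_vector_derivative)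
      show "norm (- bessel0 x / x\<^sup>2) \<le> 1 / x\<^sup>2" for x
        using bessel0_le_1[of x] by (simp add: divide_right_mono)
    qed
    then have "\<bar>?H u - ?H 1\<bar> \<le> 1"
      using \<open>u \<ge> 1\<close> by (cases "u = 1") (auto intro: order_trans)
    moreover have "\<bar>bessel0 u / u\<bar> \<le> 1"
      using bessel0_le_1[of u] \<open>u \<ge> 1\<close> by (simp add: field_simps)
    ultimately show ?thesis
      using bessel0_le_1[of 1] bessel1_le_1[of 1] bessel1_le_1[of u] by (simp only: div_by_1)
  qed
  have "continuous_on {0..1} G"
    by (intro continuous_at_imp_continuous_on ballI DERIV_isCont[OF G]) auto
  then have "bounded (G ` {0..1})"
    by (intro compact_imp_bounded compact_continuous_image) auto
  then obtain B where "\<forall>u\<in>{0..1}. \<bar>G u\<bar> \<le> B"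
    by (auto simp: bounded_iff)
  then have B: "\<bar>G u\<bar> \<le> B" if "0 \<le> u" "u \<le> 1" for u
    using that by auto
  have "\<bar>G u\<bar> \<le> max B (\<bar>G 1\<bar> + 5)" if "u \<ge> 0" for u
    using B[of u] bnd[of u] that by linarith
  with G show ?thesis by (rule that)
qed

lemma bessel0_asymptotics:
  obtains c :: complex and K :: real where "c \<noteq> 0"
    and "\<And>u. u \<ge> 1 \<Longrightarrow> \<bar>sqrt u * bessel0 u - Re (c * cis u)\<bar> \<le> K / u"
proof -
  \<comment> \<open>\<open>w\<close> solves \<open>w'' + (1 + 1 / (4 u\<^sup>2)) w = 0\<close>, so the rotated phase vector \<open>z = e\<^sup>-\<^sup>i\<^sup>u (w - i w')\<close>
    has a derivative of size \<open>O(|z| / u\<^sup>2)\<close> and converges to a nonzero limit \<open>c\<close>.\<close>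
  define w where "w u = sqrt u * bessel0 u" for u
  define w' where "w' u = bessel0 u / (2 * sqrt u) - sqrt u * bessel1 u" for u
  define z where "z u = cis (- u) * Complex (w u) (- w' u)" for u
  have w: "(w has_real_derivative w' u) (at u)" if "u > 0" for u
  proof -
    have "(w has_real_derivative (inverse (sqrt u) / 2) * bessel0 u + (- bessel1 u) * sqrt u) (at u)"
      unfolding w_def using that by (intro DERIV_mult DERIV_real_sqrt bessel0_deriv)
    moreover have "(inverse (sqrt u) / 2) * bessel0 u + (- bessel1 u) * sqrt u = w' u"
      using that by (simp add: w'_def field_simps)
    ultimately show ?thesis by metis
  qed
  \<comment> \<open>The factor sqrt u in \<open>w\<close> is chosen so that the first-order term of
    Bessel's equation cancels here.\<close>
  have w': "(w' has_real_derivative - w u - w u / (4 * u\<^sup>2)) (at u)" if "u > 0" for u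
  proof -
    have "(w' has_real_derivative
        (- bessel1 u * (2 * sqrt u) - bessel0 u * (2 * (inverse (sqrt u) / 2))) / (2 * sqrt u * (2 * sqrt u))
        - ((inverse (sqrt u) / 2) * bessel1 u + (bessel0 u - bessel1 u / u) * sqrt u)) (at u)"
      unfolding w'_def using that
      by (intro DERIV_diff DERIV_mult DERIV_divide DERIV_cmult DERIV_real_sqrt bessel0_deriv bessel1_deriv) auto
    moreover have "(- bessel1 u * (2 * sqrt u) - bessel0 u * (2 * (inverse (sqrt u) / 2))) / (2 * sqrt u * (2 * sqrt u))
        - ((inverse (sqrt u) / 2) * bessel1 u + (bessel0 u - bessel1 u / u) * sqrt u) = - w u - w u / (4 * u\<^sup>2)"
    proof -
      define r where "r = sqrt u"
      have r: "r > 0" and u: "u = r\<^sup>2" using that by (auto simp: r_def)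
      have "w u = r * bessel0 u" by (simp add: w_def r_def)
      then show ?thesis
        unfolding r_def[symmetric] using r
        by (simp add: u field_simps power2_eq_square)
    qed
    ultimately show ?thesis by metis
  qed
  have z: "(z has_vector_derivative cis (- u) * (\<i> * (w u / (4 * u\<^sup>2)))) (at u)" if "u > 0" for u
  proof -
    have "((\<lambda>u. cis (- u)) has_vector_derivative - \<i> * cis (- u)) (at u)"
      unfolding has_vector_derivative_complex_iff
      by (auto intro!: derivative_eq_intros)
    moreover have "((\<lambda>u. Complex (w u) (- w' u)) has_vector_derivative
        Complex (w' u) (- (- w u - w u / (4 * u\<^sup>2)))) (at u)"
      unfolding has_vector_derivative_complex_iff using DERIV_minus[OF w'[OF that]] w[OF that] by simp
    ultimately have D: "(z has_vector_derivative
        cis (- u) * Complex (w' u) (- (- w u - w u / (4 * u\<^sup>2))) + - \<i> * cis (- u) * Complex (w u) (- w' u)) (at u)"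
      unfolding z_def by (rule has_vector_derivative_mult)
    have comb: "a * X + - \<i> * a * Y = a * (X - \<i> * Y)" for a X Y
      by (simp add: algebra_simps)
    have "Complex (w' u) (- (- w u - w u / (4 * u\<^sup>2))) - \<i> * Complex (w u) (- w' u) = \<i> * (w u / (4 * u\<^sup>2))"
      by (simp add: complex_eq_iff)
    then have eq: "cis (- u) * Complex (w' u) (- (- w u - w u / (4 * u\<^sup>2))) + - \<i> * cis (- u) * Complex (w u) (- w' u)
        = cis (- u) * (\<i> * (w u / (4 * u\<^sup>2)))"
      using comb by metis
    from D show ?thesis unfolding eq .
  qed
  have w_z: "w u = Re (z u * cis u)" for u
  proof -
    have "z u * cis u = (cis (- u) * cis u) * Complex (w u) (- w' u)"
      by (simp add: z_def)
    then show ?thesis by (simp add: cis_mult)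
  qed
  have z': "norm (cis (- u) * (\<i> * (w u / (4 * u\<^sup>2)))) \<le> norm (z u) / (4 * u\<^sup>2)" for u
  proof -
    have "\<bar>w u\<bar> \<le> norm (z u * cis u)" unfolding w_z by (rule abs_Re_le_cmod)
    then show ?thesis by (simp add: norm_mult norm_divide norm_power divide_right_mono)
  qed
  have z_cont: "continuous_on {s..t} z" if "s > 0" for s t
    using that by (intro continuous_at_imp_continuous_on ballI has_vector_derivative_continuous[OF z]) auto
  have incr: "norm (z t - z s) \<le> B / 4 * (1 / s - 1 / t)"
    if B: "\<And>v. v \<in> {s..t} \<Longrightarrow> norm (z v) \<le> B" and st: "0 < s" "s \<le> t" for s t B
  proof (cases "s = t")
    case False
    with st have "s < t" by simp
    then have "norm (z t - z s) \<le> (- B / (4 * t)) - (- B / (4 * s))"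
    proof (rule differentiable_bound_general[where f' = "\<lambda>u. cis (- u) * (\<i> * (w u / (4 * u\<^sup>2)))"
          and \<phi>' = "\<lambda>u. B / (4 * u\<^sup>2)"])
      show "continuous_on {s..t} (\<lambda>x. - B / (4 * x))"
        using st by (auto intro!: continuous_intros)
      show "((\<lambda>x. - B / (4 * x)) has_vector_derivative B / (4 * x\<^sup>2)) (at x)" if "s < x" for x
        using that st by (auto intro!: derivative_eq_intros simp: power2_eq_square field_simps
            simp flip: has_real_derivative_iff_has_vector_derivative)
      show "norm (cis (- x) * (\<i> * (w x / (4 * x\<^sup>2)))) \<le> B / (4 * x\<^sup>2)" if "s < x" "x < t" for x
        using z'[of x] divide_right_mono[OF B[of x], of "4 * x\<^sup>2"] that by simp
    qed (use z z_cont st in auto)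
    then show ?thesis by (simp add: algebra_simps)
  qed (use st in auto)
  \<comment> \<open>Bootstrap at a point \<open>s\<close> where norm (z s) is maximal on [1, t]:
    \<open>incr\<close> with that maximum as its bound gives norm (z s) - norm (z 1) at most norm (z
    s) / 4, which absorbs the unknown maximum.\<close>
  have bound: "norm (z t) \<le> 2 * norm (z 1)" if "t \<ge> 1" for t
  proof -
    have "continuous_on {1..t} (\<lambda>v. norm (z v))"
      by (intro continuous_intros z_cont) simp
    then have "\<exists>s\<in>{1..t}. \<forall>v\<in>{1..t}. norm (z v) \<le> norm (z s)"
      using that by (intro continuous_attains_sup) auto
    then obtain s where s: "s \<in> {1..t}" "\<And>v. v \<in> {1..t} \<Longrightarrow> norm (z v) \<le> norm (z s)"
      by blast
    have "norm (z s - z 1) \<le> norm (z s) / 4 * (1 / 1 - 1 / s)"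
      using s by (intro incr) auto
    also have "\<dots> \<le> norm (z s) / 4 * 1"
      using s by (intro mult_left_mono) auto
    finally have "norm (z s) \<le> 2 * norm (z 1)"
      using norm_triangle_ineq2[of "z s" "z 1"] norm_ge_zero[of "z 1"] by linarith
    with s(2)[of t] that show ?thesis by simp
  qed
  define B where "B = 2 * norm (z 1)"
  have cauchy: "norm (z t - z s) \<le> B / 4 / s" if "1 \<le> s" "s \<le> t" for s t
  proof -
    have "norm (z t - z s) \<le> B / 4 * (1 / s - 1 / t)"
      using that bound by (intro incr) (auto simp: B_def)
    also have "\<dots> \<le> B / 4 * (1 / s)"
      using that by (intro mult_left_mono) (auto simp: B_def)
    finally show ?thesis by simp
  qed
  \<comment> \<open>The limit is taken along the integers only; since \<open>cauchy\<close> holds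
    for real \<open>s\<close>, the rate in \<open>lim\<close> still holds for every real s \<ge>
    1.\<close>
  have "\<exists>N. \<forall>m\<ge>N. \<forall>n>m. dist (z (real m)) (z (real n)) < e" if "e > 0" for e
  proof (intro exI allI impI)
    fix m n assume mn: "nat \<lceil>B / e\<rceil> + 1 \<le> m" "n > m"
    have *: "norm (z (real n) - z (real m)) \<le> B / 4 / m"
      using mn by (intro cauchy) auto
    have "B / e < m" using mn by linarith
    then have "B < e * m" using \<open>e > 0\<close> by (simp add: field_simps)
    moreover have "B \<ge> 0" by (simp add: B_def)
    ultimately have "B < e * m * 4" by linarith
    then have "B / 4 / m < e"
      using mn by (simp add: field_simps)
    with * show "dist (z (real m)) (z (real n)) < e"
      by (simp add: dist_norm norm_minus_commute)
  qed
  then have "Cauchy (\<lambda>n. z (real n))"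
    by (rule CauchyI')
  then obtain c where c: "(\<lambda>n. z (real n)) \<longlonglongrightarrow> c"
    using Cauchy_convergent convergentD by blast
  have lim: "norm (c - z s) \<le> B / 4 / s" if "s \<ge> 1" for s
  proof (rule Lim_bounded)
    show "(\<lambda>n. norm (z (real n) - z s)) \<longlonglongrightarrow> norm (c - z s)"
      by (intro tendsto_intros c)
    show "\<forall>n\<ge>nat \<lceil>s\<rceil>. norm (z (real n) - z s) \<le> B / 4 / s"
      using that cauchy[of s] by (auto simp: nat_le_iff ceiling_le_iff)
  qed
  show ?thesis
  proof
    \<comment> \<open>If \<open>c\<close> were 0, \<open>lim\<close> at s = 1 would give norm (z 1)
      \<le> B / 4 = norm (z 1) / 2, although z 1 is nonzero because w 1 = J_0(1) > 0.\<close>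
    have "Re (z 1 * cis 1) > 0"
      unfolding w_z[symmetric] using bessel0_1_pos by (simp add: w_def)
    then have "norm (z 1) > 0" by auto
    with lim[of 1] show "c \<noteq> 0"
      by (auto simp: B_def)
    fix u :: real assume u: "u \<ge> 1"
    have "\<bar>w u - Re (c * cis u)\<bar> = \<bar>Re ((z u - c) * cis u)\<bar>"
      by (simp add: w_z left_diff_distrib)
    also have "\<dots> \<le> norm ((z u - c) * cis u)"
      by (rule abs_Re_le_cmod)
    also have "\<dots> = norm (c - z u)"
      by (simp add: norm_mult norm_minus_commute)
    also have "\<dots> \<le> B / 4 / u"
      by (rule lim[OF u])
    finally show "\<bar>sqrt u * bessel0 u - Re (c * cis u)\<bar> \<le> B / 4 / u"
      by (simp add: w_def)
  qed
qed

section \<open>Spherical partial sums as Bessel integrals\<close>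

lemma integral_polar:
  fixes h :: "real \<times> real \<Rightarrow> real"
  assumes "integrable lborel h"
  shows "integrable lborel (\<lambda>r. indicator {0<..} r * r * (LINT \<theta>:{0..2*pi}|lborel. h (r * cos \<theta>, r * sin \<theta>)))"
    and "(LINT z|lborel. h z) = (LINT r|lborel. indicator {0<..} r * r * (LINT \<theta>:{0..2*pi}|lborel. h (r * cos \<theta>, r * sin \<theta>)))"
proof -
  define w :: "real \<times> real \<Rightarrow> real" where "w = (\<lambda>(r, \<theta>). indicator ({0<..} \<times> {0..2*pi}) (r, \<theta>) * r)"
  define P :: "real \<times> real \<Rightarrow> real \<times> real" where "P = (\<lambda>(r, \<theta>). (r * cos \<theta>, r * sin \<theta>))"
  have w[measurable]: "w \<in> borel_measurable (lborel \<Otimes>\<^sub>M lborel)"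
    unfolding w_def by measurable
  have P[measurable]: "P \<in> (lborel \<Otimes>\<^sub>M lborel) \<rightarrow>\<^sub>M borel"
    unfolding P_def by measurable
  have h[measurable]: "h \<in> borel_measurable borel"
    using borel_measurable_integrable[OF assms] by simp
  have w0: "AE p in lborel \<Otimes>\<^sub>M lborel. 0 \<le> w p"
    by (auto simp: w_def indicator_def split: prod.splits)
  have eq: "lborel = distr (density (lborel \<Otimes>\<^sub>M lborel) (\<lambda>p. ennreal (w p))) borel P"
    using lborel_eq_distr_polar by (simp add: w_def P_def case_prod_unfold)
  have "integrable (distr (density (lborel \<Otimes>\<^sub>M lborel) (\<lambda>p. ennreal (w p))) borel P) h"
    using assms eq by metis
  then have "integrable (density (lborel \<Otimes>\<^sub>M lborel) (\<lambda>p. ennreal (w p))) (\<lambda>p. h (P p))"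
    by (subst (asm) integrable_distr_eq) auto
  then have int: "integrable (lborel \<Otimes>\<^sub>M lborel) (\<lambda>p. w p * h (P p))"
    by (subst (asm) integrable_density) (use w0 in auto)
  have inner: "(LINT \<theta>|lborel. w (r, \<theta>) * h (P (r, \<theta>))) =
      indicator {0<..} r * r * (LINT \<theta>:{0..2*pi}|lborel. h (r * cos \<theta>, r * sin \<theta>))" for r
    unfolding set_lebesgue_integral_def integral_mult_right_zero[symmetric]
    by (intro Bochner_Integration.integral_cong) (auto simp: w_def P_def indicator_def)
  show "integrable lborel (\<lambda>r. indicator {0<..} r * r * (LINT \<theta>:{0..2*pi}|lborel. h (r * cos \<theta>, r * sin \<theta>)))"
    using lborel_pair.integrable_fst'[OF int] unfolding inner .
  have "(LINT z|lborel. h z) = (LINT z|distr (density (lborel \<Otimes>\<^sub>M lborel) (\<lambda>p. ennreal (w p))) borel P. h z)"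
    using eq by metis
  also have "\<dots> = (LINT p|(density (lborel \<Otimes>\<^sub>M lborel) (\<lambda>p. ennreal (w p))). h (P p))"
    by (rule integral_distr) auto
  also have "\<dots> = (LINT p|(lborel \<Otimes>\<^sub>M lborel). w p * h (P p))"
    by (subst integral_density) (use w0 in auto)
  also have "\<dots> = (LINT r|lborel. LINT \<theta>|lborel. w (r, \<theta>) * h (P (r, \<theta>)))"
    by (rule lborel_pair.integral_fst'[OF int, symmetric])
  finally show "(LINT z|lborel. h z) = (LINT r|lborel. indicator {0<..} r * r * (LINT \<theta>:{0..2*pi}|lborel. h (r * cos \<theta>, r * sin \<theta>)))"
    unfolding inner .
qed

text \<open>Used to replace \<open>f\<close> by a Borel representative on almost every circle. The
  polar density is positive for r > 0, so a null set of the plane pulls back to a null set of pairs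
  of radius and angle, which Fubini slices by radius.\<close>

lemma AE_polar:
  assumes "AE z in lborel. Q z"
  shows "AE r in lborel. r > 0 \<longrightarrow> (AE \<theta> in lborel. \<theta> \<in> {0..2*pi} \<longrightarrow> Q (r * cos \<theta>, r * sin \<theta>))"
proof -
  let ?P = "\<lambda>(r, \<theta>). (r * cos \<theta>, r * sin \<theta>) :: real \<times> real"
  let ?w = "\<lambda>(r, \<theta>). ennreal (indicator ({0<..} \<times> {0..2*pi}) (r, \<theta>) * r)"
  have "AE z in distr (density (lborel \<Otimes>\<^sub>M lborel) ?w) borel ?P. Q z"
    using assms by (subst (asm) lborel_eq_distr_polar)
  moreover have "?P \<in> density (lborel \<Otimes>\<^sub>M lborel) ?w \<rightarrow>\<^sub>M borel"
    by simp
  ultimately have "AE p in density (lborel \<Otimes>\<^sub>M lborel) ?w. Q (?P p)"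
    by (rule AE_distrD[rotated])
  then have "AE p in lborel \<Otimes>\<^sub>M lborel. 0 < ?w p \<longrightarrow> Q (?P p)"
    by (subst (asm) AE_density) auto
  from lborel_pair.AE_pair[OF this]
  show ?thesis
    by (auto simp: indicator_def elim!: eventually_mono)
qed

text \<open>Rotation invariance, proved by differentiating in \<phi>: the resulting integrand is
  also the \<theta>-derivative of -cos (u cos (\<theta> - \<phi>)), so its integral over a period is
  0.\<close>

lemma integral_cos_shift:
  "integral {0..2*pi} (\<lambda>\<theta>. cos (u * cos (\<theta> - \<phi>))) = 2 * pi * bessel0 u"
proof -
  define I where "I \<phi> = integral (cbox 0 (2*pi)) (\<lambda>\<theta>. cos (u * cos (\<theta> - \<phi>)))" for \<phi>
  have "(I has_real_derivative 0) (at \<phi>)" for \<phi>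
  proof -
    have "(I has_real_derivative integral (cbox 0 (2*pi)) (\<lambda>\<theta>. - (sin (u * cos (\<theta> - \<phi>)) * (u * sin (\<theta> - \<phi>))))) (at \<phi>)"
      unfolding I_def
      by (rule leibniz_rule_field_derivative[where U = UNIV])
         (auto intro!: derivative_eq_intros continuous_intros integrable_continuous_real simp: case_prod_unfold)
    moreover have "((\<lambda>\<theta>. - (sin (u * cos (\<theta> - \<phi>)) * (u * sin (\<theta> - \<phi>)))) has_integral
        - cos (u * cos (2*pi - \<phi>)) - - cos (u * cos (0 - \<phi>))) {0..2*pi}"
      by (rule fundamental_theorem_of_calculus)
         (auto intro!: derivative_eq_intros simp flip: has_real_derivative_iff_has_vector_derivative)
    then have "integral (cbox 0 (2*pi)) (\<lambda>\<theta>. - (sin (u * cos (\<theta> - \<phi>)) * (u * sin (\<theta> - \<phi>)))) = 0"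
      by (simp only: integral_unique cbox_interval) (simp add: cos_diff)
    ultimately show ?thesis by simp
  qed
  then have "I \<phi> = I 0" by (intro DERIV_isconst_all) auto
  then show ?thesis by (simp add: I_def bessel0_def)
qed

text \<open>Polar coordinates reduce the integral to 2 pi \<rho> J_0(\<rho> r) over 0 \<le> \<rho>
  \<le> M, and (u J_1(u))' = u J_0(u) supplies the primitive.\<close>

lemma disc_kernel:
  assumes "M > 0" "r > 0"
  shows "(LINT \<xi>|lborel. indicator {(\<xi>1, \<xi>2). \<xi>1\<^sup>2 + \<xi>2\<^sup>2 \<le> M\<^sup>2} \<xi> * cos (fst \<xi> * (r * cos \<phi>) + snd \<xi> * (r * sin \<phi>)))
    = 2 * pi * M * bessel1 (M * r) / r"
proof -
  define B where "B = {(\<xi>1, \<xi>2). \<xi>1\<^sup>2 + \<xi>2\<^sup>2 \<le> M\<^sup>2}"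
  define h where "h \<xi> = indicator B \<xi> * cos (fst \<xi> * (r * cos \<phi>) + snd \<xi> * (r * sin \<phi>))" for \<xi>
  have "B = cball 0 M"
    using assms by (auto simp: B_def dist_norm norm_prod_def real_sqrt_le_iff' intro: real_le_lsqrt)
  then have "compact B" by simp
  then have "integrable lborel (\<lambda>\<xi>. indicator B \<xi> *\<^sub>R cos (fst \<xi> * (r * cos \<phi>) + snd \<xi> * (r * sin \<phi>)))"
    by (intro borel_integrable_compact continuous_intros)
  then have "integrable lborel h" by (simp add: h_def[abs_def])
  have ang: "(LINT \<theta>:{0..2*pi}|lborel. h (\<rho> * cos \<theta>, \<rho> * sin \<theta>)) = indicator {..M} \<rho> * (2 * pi * bessel0 (\<rho> * r))"
    if "\<rho> > 0" for \<rho>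
  proof -
    have "(\<rho> * cos \<theta>)\<^sup>2 + (\<rho> * sin \<theta>)\<^sup>2 = \<rho>\<^sup>2" for \<theta>
      by (simp add: power_mult_distrib flip: distrib_left)
    moreover have "\<rho>\<^sup>2 \<le> M\<^sup>2 \<longleftrightarrow> \<rho> \<le> M"
      using assms that by (simp add: power2_le_iff_abs_le abs_le_square_iff[symmetric])
    moreover have "\<rho> * cos \<theta> * (r * cos \<phi>) + \<rho> * sin \<theta> * (r * sin \<phi>) = (\<rho> * r) * cos (\<theta> - \<phi>)" for \<theta>
      by (simp add: cos_diff algebra_simps)
    ultimately have "h (\<rho> * cos \<theta>, \<rho> * sin \<theta>) = indicator {..M} \<rho> * cos ((\<rho> * r) * cos (\<theta> - \<phi>))" for \<theta>
      by (simp add: h_def B_def indicator_def)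
    then have "(LINT \<theta>:{0..2*pi}|lborel. h (\<rho> * cos \<theta>, \<rho> * sin \<theta>))
        = indicator {..M} \<rho> * (LINT \<theta>:{0..2*pi}|lborel. cos ((\<rho> * r) * cos (\<theta> - \<phi>)))"
      by simp
    also have "(LINT \<theta>:{0..2*pi}|lborel. cos ((\<rho> * r) * cos (\<theta> - \<phi>))) = integral {0..2*pi} (\<lambda>\<theta>. cos ((\<rho> * r) * cos (\<theta> - \<phi>)))"
      by (intro set_borel_integral_eq_integral borel_integrable_atLeastAtMost' continuous_intros)
    finally show ?thesis by (simp add: integral_cos_shift)
  qed
  have "(LINT \<xi>|lborel. h \<xi>) = (LINT \<rho>|lborel. indicator {0<..} \<rho> * \<rho> * (LINT \<theta>:{0..2*pi}|lborel. h (\<rho> * cos \<theta>, \<rho> * sin \<theta>)))"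
    by (rule integral_polar) fact
  also have "\<dots> = (LINT \<rho>:{0..M}|lborel. 2 * pi * (\<rho> * bessel0 (\<rho> * r)))"
  proof -
    have "indicator {0<..} \<rho> * \<rho> * (LINT \<theta>:{0..2*pi}|lborel. h (\<rho> * cos \<theta>, \<rho> * sin \<theta>))
        = indicator {0..M} \<rho> *\<^sub>R (2 * pi * (\<rho> * bessel0 (\<rho> * r)))" for \<rho>
      by (cases "\<rho> > 0") (auto simp: ang indicator_def)
    then show ?thesis
      unfolding set_lebesgue_integral_def[of _ "{0..M}"] by (rule Bochner_Integration.integral_cong[OF refl])
  qed
  also have "\<dots> = integral {0..M} (\<lambda>\<rho>. 2 * pi * (\<rho> * bessel0 (\<rho> * r)))"
    by (intro set_borel_integral_eq_integral borel_integrable_atLeastAtMost' continuous_intros)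
  finally have lint: "(LINT \<xi>|lborel. h \<xi>) = integral {0..M} (\<lambda>\<rho>. 2 * pi * (\<rho> * bessel0 (\<rho> * r)))" .
  have "((\<lambda>\<rho>. 2 * pi * (\<rho> * bessel0 (\<rho> * r))) has_integral
      2 * pi * (M * bessel1 (M * r) / r) - 2 * pi * (0 * bessel1 (0 * r) / r)) {0..M}"
  \<comment> \<open>The interior version asks for no derivative at 0, the point excluded by
    \<open>bessel1_deriv\<close>.\<close>
  proof (rule fundamental_theorem_of_calculus_interior)
    show "continuous_on {0..M} (\<lambda>\<rho>. 2 * pi * (\<rho> * bessel1 (\<rho> * r) / r))"
      using assms by (intro continuous_intros) auto
    fix \<rho> assume "\<rho> \<in> {0<..<M}"
    then show "((\<lambda>\<rho>. 2 * pi * (\<rho> * bessel1 (\<rho> * r) / r)) has_vector_derivative 2 * pi * (\<rho> * bessel0 (\<rho> * r))) (at \<rho>)"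
      using assms
      by (auto intro!: derivative_eq_intros DERIV_chain2[OF bessel1_deriv] simp: field_simps
          simp flip: has_real_derivative_iff_has_vector_derivative)
  qed (use assms in auto)
  from integral_unique[OF this] have "(LINT \<xi>|lborel. h \<xi>) = 2 * pi * M * bessel1 (M * r) / r"
    unfolding lint by simp
  then show ?thesis by (simp add: h_def B_def)
qed

text \<open>Exchanging the frequency and space integrals makes the partial sum a convolution of
  \<open>f\<close> with the disc kernel, which is radial; around \<open>x\<close> only the circle
  averages of \<open>f\<close> remain. The integrability claim lets the Lebesgue integral be
  identified later with a gauge integral.\<close>

lemma spherical_partial_sum_eq_bessel_integral:
  fixes f :: "real \<times> real \<Rightarrow> real"
  assumes f: "integrable lebesgue f" and M: "M > 0"
    and A: "finite A" "\<And>r. r \<in> {0<..} - A \<Longrightarrow> spherical_mean_exists f x r"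
    and g: "continuous_on ({0<..} - A) (spherical_mean f x)"
  shows "integrable lborel (\<lambda>r. indicator ({0<..} - A) r * (spherical_mean f x r * (M * bessel1 (M * r))))"
    and "Re (spherical_partial_sum f M x) =
      (LINT r|lborel. indicator ({0<..} - A) r * (spherical_mean f x r * (M * bessel1 (M * r))))"
proof -
  obtain x1 x2 where x: "x = (x1, x2)" by (cases x)
  \<comment> \<open>Fubini and the polar formula are applied on Borel product spaces, so a Borel
    representative takes the place of \<open>f\<close>.\<close>
  obtain f' where f'[measurable]: "f' \<in> borel_measurable lborel" and ae: "AE z in lborel. f z = f' z"
    using completion_ex_borel_measurable_real[OF borel_measurable_integrable[OF f]] by auto
  have f_meas[measurable]: "f \<in> borel_measurable lebesgue" using f by simp
  have f'_leb: "f' \<in> borel_measurable lebesgue" using f' by (rule measurable_completion)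
  have ae_leb: "AE z in lebesgue. f z = f' z" using ae by (rule AE_completion)
  have "integrable lebesgue f'"
    using f ae_leb f'_leb by (subst (asm) integrable_cong_AE[OF _ f'_leb]) auto
  then have int_f': "integrable lborel f'"
    using f' by (simp add: integrable_completion)

  define B :: "(real \<times> real) set" where "B = {(\<xi>1, \<xi>2). \<xi>1\<^sup>2 + \<xi>2\<^sup>2 \<le> M\<^sup>2}"
  have B_eq: "B = cball 0 M"
    using M by (auto simp: B_def dist_norm norm_prod_def real_sqrt_le_iff' intro: real_le_lsqrt)
  have [measurable]: "B \<in> sets borel" unfolding B_eq by simp
  have int_B: "integrable lborel (indicator B :: _ \<Rightarrow> real)"
    unfolding B_eq using emeasure_lborel_cball_finite[of "0 :: real \<times> real" M]
    by (subst integrable_indicator_iff) auto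
  define c where "c = 1 / (2 * pi)\<^sup>2"
  \<comment> \<open>The joint integrand in frequency and space. Its modulus is c times the indicator
    of \<open>B\<close> times |f'|, which is integrable on the product.\<close>
  define \<Phi> :: "real \<times> real \<Rightarrow> real \<times> real \<Rightarrow> complex" where
    "\<Phi> \<xi> y = of_real (c * indicator B \<xi> * f' y) * cis (fst \<xi> * (x1 - fst y) + snd \<xi> * (x2 - snd y))" for \<xi> y
  have fourier: "fourier_transform_2d f \<xi> =
     of_real c * (LINT y|lborel. of_real (f' y) * cis (- (fst \<xi> * fst y + snd \<xi> * snd y)))" for \<xi>
  proof -
    have cis: "(\<lambda>y. cis (- (fst \<xi> * fst y + snd \<xi> * snd y))) \<in> borel_measurable lborel"
      unfolding measurable_lborel2 by (intro borel_measurable_continuous_onI continuous_intros)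
    have meas: "(\<lambda>y. of_real (f' y) * cis (- (fst \<xi> * fst y + snd \<xi> * snd y))) \<in> borel_measurable lborel"
      by (intro borel_measurable_times cis) measurable
    have "(LINT y|lebesgue. of_real (f y) * cis (- (fst \<xi> * fst y + snd \<xi> * snd y)))
        = (LINT y|lebesgue. of_real (f' y) * cis (- (fst \<xi> * fst y + snd \<xi> * snd y)))"
    proof (rule integral_cong_AE)
      show "(\<lambda>y. of_real (f y) * cis (- (fst \<xi> * fst y + snd \<xi> * snd y))) \<in> borel_measurable lebesgue"
        by (intro borel_measurable_times measurable_completion[OF cis]) measurable
      show "(\<lambda>y. of_real (f' y) * cis (- (fst \<xi> * fst y + snd \<xi> * snd y))) \<in> borel_measurable lebesgue"
        by (rule measurable_completion[OF meas])
    qed (use ae_leb in auto)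
    also have "\<dots> = (LINT y|lborel. of_real (f' y) * cis (- (fst \<xi> * fst y + snd \<xi> * snd y)))"
      by (rule integral_completion[OF meas])
    finally show ?thesis
      by (simp add: fourier_transform_2d_def case_prod_unfold c_def cis_conv_exp algebra_simps)
  qed
  have \<Phi>_meas: "case_prod \<Phi> \<in> borel_measurable (lborel \<Otimes>\<^sub>M lborel)"
  proof -
    have "(\<lambda>p. cis (fst (fst p) * (x1 - fst (snd p)) + snd (fst p) * (x2 - snd (snd p))))
        \<in> borel_measurable (lborel :: ((real \<times> real) \<times> (real \<times> real)) measure)"
      unfolding measurable_lborel2 by (intro borel_measurable_continuous_onI continuous_intros)
    then have "(\<lambda>p. cis (fst (fst p) * (x1 - fst (snd p)) + snd (fst p) * (x2 - snd (snd p))))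
        \<in> borel_measurable (lborel \<Otimes>\<^sub>M lborel)"
      by (simp add: lborel_prod)
    moreover have "(\<lambda>p. complex_of_real (c * indicator B (fst p) * f' (snd p))) \<in> borel_measurable (lborel \<Otimes>\<^sub>M lborel)"
      by measurable
    ultimately show ?thesis
      unfolding \<Phi>_def case_prod_unfold by (rule borel_measurable_times[rotated])
  qed
  have int_\<Phi>: "integrable (lborel \<Otimes>\<^sub>M lborel) (case_prod \<Phi>)"
  proof (rule lborel_pair.Fubini_integrable[OF \<Phi>_meas])
    have norm_\<Phi>: "norm (\<Phi> \<xi> y) = c * indicator B \<xi> * norm (f' y)" for \<xi> y
      unfolding \<Phi>_def norm_mult norm_of_real norm_cis
      by (simp add: abs_mult c_def indicator_def)
    show "integrable lborel (\<lambda>\<xi>. LINT y|lborel. norm (case_prod \<Phi> (\<xi>, y)))"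
      using int_B by (simp add: norm_\<Phi> mult.commute[of c])
    show "AE \<xi> in lborel. integrable lborel (\<lambda>y. case_prod \<Phi> (\<xi>, y))"
    proof (intro AE_I2)
      fix \<xi> :: "real \<times> real"
      show "integrable lborel (\<lambda>y. case_prod \<Phi> (\<xi>, y))"
      proof (rule Bochner_Integration.integrable_bound)
        show "integrable lborel (\<lambda>y. c * indicator B \<xi> * norm (f' y))"
          using int_f' by auto
        show "(\<lambda>y. case_prod \<Phi> (\<xi>, y)) \<in> borel_measurable lborel"
          using \<Phi>_meas by (rule measurable_Pair2) simp
      qed (simp add: norm_\<Phi> c_def)
    qed
  qed
  define D where "D v = (LINT \<xi>|lborel. indicator B \<xi> * cos (fst \<xi> * fst v + snd \<xi> * snd v))" for v
  have D: "D (r * cos \<theta>, r * sin \<theta>) = 2 * pi * M * bessel1 (M * r) / r" if "r > 0" for r \<theta>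
    using disc_kernel[OF M that, of \<theta>] by (simp add: D_def B_def)
  have "spherical_partial_sum f M x = (LINT \<xi>|lborel. LINT y|lborel. \<Phi> \<xi> y)"
  proof -
    have "indicator B \<xi> *\<^sub>R (fourier_transform_2d f \<xi> * exp (\<i> * complex_of_real (fst \<xi> * x1 + snd \<xi> * x2)))
        = (LINT y|lborel. \<Phi> \<xi> y)" for \<xi>
    proof -
      have "(LINT y|lborel. \<Phi> \<xi> y) = (LINT y|lborel. of_real (c * indicator B \<xi>) * cis (fst \<xi> * x1 + snd \<xi> * x2) *
          (of_real (f' y) * cis (- (fst \<xi> * fst y + snd \<xi> * snd y))))"
      proof (rule Bochner_Integration.integral_cong[OF refl])
        fix y
        have "cis (fst \<xi> * (x1 - fst y) + snd \<xi> * (x2 - snd y)) =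
            cis (fst \<xi> * x1 + snd \<xi> * x2) * cis (- (fst \<xi> * fst y + snd \<xi> * snd y))"
          by (simp add: cis_mult algebra_simps)
        then show "\<Phi> \<xi> y = of_real (c * indicator B \<xi>) * cis (fst \<xi> * x1 + snd \<xi> * x2) *
            (of_real (f' y) * cis (- (fst \<xi> * fst y + snd \<xi> * snd y)))"
          by (simp add: \<Phi>_def mult_ac)
      qed
      also have "\<dots> = of_real (c * indicator B \<xi>) * cis (fst \<xi> * x1 + snd \<xi> * x2) *
          (LINT y|lborel. of_real (f' y) * cis (- (fst \<xi> * fst y + snd \<xi> * snd y)))"
        by (rule integral_mult_right_zero)
      finally show ?thesis
        by (simp add: fourier cis_conv_exp scaleR_conv_of_real mult_ac)
    qed
    then show ?thesis
      by (simp add: x spherical_partial_sum_def set_lebesgue_integral_def case_prod_unfold B_def)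
  qed
  also have "\<dots> = (LINT p|(lborel \<Otimes>\<^sub>M lborel). case_prod \<Phi> p)"
    using lborel_pair.integral_fst'[OF int_\<Phi>] by simp
  finally have "Re (spherical_partial_sum f M x) = (LINT p|(lborel \<Otimes>\<^sub>M lborel). Re (case_prod \<Phi> p))"
    using integral_Re[OF int_\<Phi>] by simp
  moreover have int_Re: "integrable (lborel \<Otimes>\<^sub>M lborel) (\<lambda>(\<xi>, y). Re (\<Phi> \<xi> y))"
    using integrable_Re[OF int_\<Phi>] by (simp add: case_prod_unfold)
  \<comment> \<open>Integrating out the frequency leaves the kernel \<open>D\<close>; evenness of
    the cosine allows the offset to be written y - x.\<close>
  have inner: "(LINT \<xi>|lborel. Re (\<Phi> \<xi> y)) = c * f' y * D (y - x)" for y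
  proof -
    have "Re (\<Phi> \<xi> y) = c * f' y * (indicator B \<xi> * cos (fst \<xi> * fst (y - x) + snd \<xi> * snd (y - x)))" for \<xi>
    proof -
      have "fst \<xi> * (x1 - fst y) + snd \<xi> * (x2 - snd y) = - (fst \<xi> * fst (y - x) + snd \<xi> * snd (y - x))"
        by (simp add: x algebra_simps)
      then have "cos (fst \<xi> * (x1 - fst y) + snd \<xi> * (x2 - snd y)) = cos (fst \<xi> * fst (y - x) + snd \<xi> * snd (y - x))"
        by (simp only: cos_minus)
      then show ?thesis by (simp add: \<Phi>_def)
    qed
    then show ?thesis by (simp add: D_def)
  qed
  ultimately have "Re (spherical_partial_sum f M x) = (LINT y|lborel. c * f' y * D (y - x))"
    using lborel_pair.integral_snd[OF int_Re] by (simp add: inner case_prod_unfold)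
  moreover have int_D: "integrable lborel (\<lambda>y. c * f' y * D (y - x))"
    using lborel_pair.integrable_snd[OF int_Re] by (simp add: inner)
  \<comment> \<open>Translation by \<open>x\<close> moves the centre of the circles to the origin,
    where \<open>integral_polar\<close> applies.\<close>
  moreover have "lborel = distr lborel borel ((+) x)"
    by (rule lborel_distr_plus[symmetric])
  ultimately have "integrable (distr lborel borel ((+) x)) (\<lambda>y. c * f' y * D (y - x))"
    "Re (spherical_partial_sum f M x) = (LINT y|distr lborel borel ((+) x). c * f' y * D (y - x))"
    by simp_all
  moreover have "(\<lambda>y. c * f' y * D (y - x)) \<in> borel_measurable borel"
    using borel_measurable_integrable[OF int_D] by simp
  ultimately have sps: "integrable lborel (\<lambda>v. c * f' (x + v) * D v)"
    "Re (spherical_partial_sum f M x) = (LINT v|lborel. c * f' (x + v) * D v)"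
    by (simp_all add: integrable_distr_eq integral_distr)
  define G where "G r = indicator {0<..} r * r * (LINT \<theta>:{0..2*pi}|lborel. c * f' (x + (r * cos \<theta>, r * sin \<theta>)) * D (r * cos \<theta>, r * sin \<theta>))" for r
  have G: "integrable lborel G" "Re (spherical_partial_sum f M x) = (LINT r|lborel. G r)"
    using integral_polar[OF sps(1)] sps(2) by (simp_all add: G_def[abs_def])
  have "AE v in lborel. f (x + v) = f' (x + v)"
  proof -
    have "AE v in distr lborel borel ((+) x). f v = f' v"
      using ae unfolding lborel_distr_plus .
    then show ?thesis by (rule AE_distrD[rotated]) simp
  qed
  from AE_polar[OF this]
  have ae_r: "AE r in lborel. r > 0 \<longrightarrow> (AE \<theta> in lborel. \<theta> \<in> {0..2*pi} \<longrightarrow>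
      f (x + (r * cos \<theta>, r * sin \<theta>)) = f' (x + (r * cos \<theta>, r * sin \<theta>)))" .
  let ?H = "\<lambda>r. indicator ({0<..} - A) r * (spherical_mean f x r * (M * bessel1 (M * r)))"
  have H_meas: "?H \<in> borel_measurable lborel"
  proof -
    have "open ({0<..} - A)" using A(1) by (auto intro: finite_imp_closed)
    then have "(\<lambda>r. indicator ({0<..} - A) r *\<^sub>R (spherical_mean f x r * (M * bessel1 (M * r)))) \<in> borel_measurable borel"
      using g by (intro borel_measurable_continuous_on_indicator continuous_intros) auto
    then show ?thesis by simp
  qed
  have "AE r in lborel. \<forall>a\<in>A. r \<noteq> a"
    using A(1) by (intro AE_finite_allI AE_lborel_singleton)
  with ae_r have eq: "AE r in lborel. G r = ?H r"
  proof eventually_elim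
    case (elim r)
    show ?case
    proof (cases "r > 0")
      case True
      with elim have ae_\<theta>: "AE \<theta> in lborel. \<theta> \<in> {0..2*pi} \<longrightarrow>
          f (x + (r * cos \<theta>, r * sin \<theta>)) = f' (x + (r * cos \<theta>, r * sin \<theta>))"
        and r: "r \<in> {0<..} - A" by auto
      have meas: "(\<lambda>\<theta>. indicator {0..2*pi} \<theta> *\<^sub>R f' (x + (r * cos \<theta>, r * sin \<theta>))) \<in> borel_measurable lborel"
      proof -
        have "(\<lambda>\<theta>. x + (r * cos \<theta>, r * sin \<theta>)) \<in> lborel \<rightarrow>\<^sub>M lborel"
          unfolding measurable_lborel2 measurable_lborel1 by (intro borel_measurable_continuous_onI continuous_intros)
        from measurable_compose[OF this f'] show ?thesis by measurable
      qed
      have "(LINT \<theta>:{0..2*pi}|lebesgue. f (x + (r * cos \<theta>, r * sin \<theta>)))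
          = (LINT \<theta>:{0..2*pi}|lebesgue. f' (x + (r * cos \<theta>, r * sin \<theta>)))"
        unfolding set_lebesgue_integral_def
      proof (rule integral_cong_AE)
        \<comment> \<open>Planar measurability of \<open>f\<close> says nothing about a given
          circle, which is a null set; measurability along this one comes from
          \<open>spherical_mean_exists\<close>.\<close>
        show "(\<lambda>\<theta>. indicator {0..2*pi} \<theta> *\<^sub>R f (x + (r * cos \<theta>, r * sin \<theta>))) \<in> borel_measurable lebesgue"
          using A(2)[OF r] by (simp add: spherical_mean_exists_def x set_integrable_def borel_measurable_integrable)
        show "(\<lambda>\<theta>. indicator {0..2*pi} \<theta> *\<^sub>R f' (x + (r * cos \<theta>, r * sin \<theta>))) \<in> borel_measurable lebesgue"
          using meas by (rule measurable_completion)
        show "AE \<theta> in lebesgue. indicator {0..2*pi} \<theta> *\<^sub>R f (x + (r * cos \<theta>, r * sin \<theta>))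
            = indicator {0..2*pi} \<theta> *\<^sub>R f' (x + (r * cos \<theta>, r * sin \<theta>))"
          using AE_completion[OF ae_\<theta>] by eventually_elim (auto simp: indicator_def)
      qed
      also have "\<dots> = (LINT \<theta>:{0..2*pi}|lborel. f' (x + (r * cos \<theta>, r * sin \<theta>)))"
        unfolding set_lebesgue_integral_def by (rule integral_completion[OF meas])
      finally have mean: "2 * pi * spherical_mean f x r = (LINT \<theta>:{0..2*pi}|lborel. f' (x + (r * cos \<theta>, r * sin \<theta>)))"
        by (simp add: spherical_mean_def x)
      \<comment> \<open>On the circle the kernel is constant, its 1/r cancels the Jacobian
        \<open>r\<close>, and (2 pi)^2 c = 1.\<close>
      have "G r = r * (LINT \<theta>:{0..2*pi}|lborel. c * (2 * pi * M * bessel1 (M * r) / r) * f' (x + (r * cos \<theta>, r * sin \<theta>)))"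
        unfolding G_def D[OF True] using True by (simp add: mult_ac)
      also have "\<dots> = r * (c * (2 * pi * M * bessel1 (M * r) / r)) * (2 * pi * spherical_mean f x r)"
        unfolding mean by simp
      also have "\<dots> = ?H r"
        using r by (simp add: c_def power2_eq_square)
      finally show ?thesis .
    qed (simp add: G_def)
  qed
  show "integrable lborel ?H"
    using G(1) integrable_cong_AE[OF borel_measurable_integrable[OF G(1)] H_meas eq] by blast
  show "Re (spherical_partial_sum f M x) = (LINT r|lborel. ?H r)"
    unfolding G(2) by (rule integral_cong_AE[OF borel_measurable_integrable[OF G(1)] H_meas eq])
qed

section \<open>Integration by parts with jumps\<close>

text \<open>Serves the mean and its first two derivatives alike. The one-sided limits are
  parameters, so that a jump is simply \<open>r a - l a\<close>.\<close>

definition piecewise_cont :: "real set \<Rightarrow> (real \<Rightarrow> real) \<Rightarrow> (real \<Rightarrow> real) \<Rightarrow> (real \<Rightarrow> real) \<Rightarrow> bool" where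
  "piecewise_cont A g l r \<longleftrightarrow> finite A \<and> A \<subseteq> {0<..} \<and> continuous_on ({0<..} - A) g \<and>
     (\<forall>a\<in>A. (g \<longlongrightarrow> l a) (at_left a)) \<and> (\<forall>a\<in>insert 0 A. (g \<longlongrightarrow> r a) (at_right a))"

lemma tendsto_of_bool_le_at_right:
  fixes a x :: real
  shows "((\<lambda>y. of_bool (a \<le> y) :: real) \<longlongrightarrow> of_bool (a \<le> x)) (at_right x)"
proof (rule tendsto_eventually)
  show "\<forall>\<^sub>F y in at_right x. (of_bool (a \<le> y) :: real) = of_bool (a \<le> x)"
  proof (cases "a \<le> x")
    case True
    then show ?thesis using eventually_at_right_less[of x] by (auto elim: eventually_mono)
  next
    case False
    then have "\<forall>\<^sub>F y in at_right x. y < a" by (intro eventually_at_rightI[of x a]) auto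
    then show ?thesis using False by (auto elim: eventually_mono)
  qed
qed

lemma tendsto_of_bool_le_at_left:
  fixes a x :: real
  shows "((\<lambda>y. of_bool (a \<le> y) :: real) \<longlongrightarrow> of_bool (a < x)) (at_left x)"
proof (rule tendsto_eventually)
  show "\<forall>\<^sub>F y in at_left x. (of_bool (a \<le> y) :: real) = of_bool (a < x)"
  proof (cases "a < x")
    case False
    have "\<forall>\<^sub>F y in at_left x. y < x" by (simp add: eventually_at_filter)
    then show ?thesis using False by (auto elim: eventually_mono)
  next
    case True
    then have "\<forall>\<^sub>F y in at_left x. a < y" by (intro eventually_at_leftI[of a x]) auto
    then show ?thesis using True by (auto elim: eventually_mono)
  qed
qed

lemma piecewise_cont_isCont:
  assumes "piecewise_cont A g l r" "x > 0" "x \<notin> A"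
  shows "isCont g x"
proof -
  have "open ({0<..} - A)"
    using assms(1) by (auto simp: piecewise_cont_def intro: finite_imp_closed)
  then show ?thesis
    using assms by (auto simp: piecewise_cont_def continuous_on_eq_continuous_at)
qed

text \<open>Subtracting a step of height \<open>r a - l a\<close> at each break point removes every
  jump. Boundedness, integrability and integration by parts then reduce to a continuous function
  plus finitely many steps.\<close>

lemma piecewise_cont_regularize:
  assumes "piecewise_cont A g l r"
  obtains h where "continuous_on {0..} h" "h 0 = r 0"
    "\<And>x. x > 0 \<Longrightarrow> x \<notin> A \<Longrightarrow> h x = g x - (\<Sum>a\<in>A. (r a - l a) * of_bool (a \<le> x))"
proof -
  let ?s = "\<lambda>x. \<Sum>a\<in>A. (r a - l a) * of_bool (a \<le> x)"
  \<comment> \<open>The right limit is used at break points because the steps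
    \<open>of_bool (a \<le> x)\<close> are right-continuous.\<close>
  define h where "h x = (if x \<in> insert 0 A then r x else g x) - ?s x" for x
  have A: "finite A" "A \<subseteq> {0<..}"
    and l: "\<And>a. a \<in> A \<Longrightarrow> (g \<longlongrightarrow> l a) (at_left a)"
    and r: "\<And>a. a \<in> insert 0 A \<Longrightarrow> (g \<longlongrightarrow> r a) (at_right a)"
    using assms by (auto simp: piecewise_cont_def)
  have h0: "h 0 = r 0"
    using A by (auto simp: h_def intro!: sum.neutral)
  have h_eq: "h x = g x - ?s x" if "x > 0" "x \<notin> A" for x
    using that by (simp add: h_def)
  have ev: "\<forall>\<^sub>F y in at x within S. h y = g y - ?s y" for x S
  proof -
    have "\<forall>\<^sub>F y in at x within S. \<forall>b\<in>insert 0 A. y \<noteq> b"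
      using A by (intro eventually_ball_finite ballI eventually_neq_at_within) auto
    then show ?thesis by eventually_elim (auto simp: h_def)
  qed
  have right: "(h \<longlongrightarrow> h x) (at_right x)" if "x \<ge> 0" for x
  proof -
    have "(g \<longlongrightarrow> (if x \<in> insert 0 A then r x else g x)) (at_right x)"
      using r[of x] piecewise_cont_isCont[OF assms, of x] that
      by (auto simp: isCont_def intro: tendsto_within_subset)
    then have "((\<lambda>y. g y - ?s y) \<longlongrightarrow> h x) (at_right x)"
      unfolding h_def by (intro tendsto_intros tendsto_of_bool_le_at_right)
    then show ?thesis using tendsto_cong[OF ev] by simp
  qed
  have left: "(h \<longlongrightarrow> h x) (at_left x)" if "x > 0" for x
  proof -
    have "(g \<longlongrightarrow> (if x \<in> A then l x else g x)) (at_left x)"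
      using l[of x] piecewise_cont_isCont[OF assms, of x] that
      by (auto simp: isCont_def intro: tendsto_within_subset)
    then have "((\<lambda>y. g y - ?s y) \<longlongrightarrow> (if x \<in> A then l x else g x) - (\<Sum>a\<in>A. (r a - l a) * of_bool (a < x))) (at_left x)"
      by (intro tendsto_intros tendsto_of_bool_le_at_left)
    \<comment> \<open>At a break point the two sums differ by exactly the jump, which compensates
      the passage from \<open>l x\<close> to \<open>r x\<close>.\<close>
    moreover have "?s x = (\<Sum>a\<in>A. (r a - l a) * of_bool (a < x)) + (\<Sum>a\<in>A. if a = x then r a - l a else 0)"
      unfolding sum.distrib[symmetric] by (intro sum.cong) auto
    then have "(if x \<in> A then l x else g x) - (\<Sum>a\<in>A. (r a - l a) * of_bool (a < x)) = h x"
      using A that by (auto simp: h_def sum.delta)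
    ultimately show ?thesis using tendsto_cong[OF ev] by simp
  qed
  have "continuous_on {0..} h"
    unfolding continuous_on_eq_continuous_within continuous_within
  proof (intro ballI)
    fix x :: real assume x: "x \<in> {0..}"
    show "(h \<longlongrightarrow> h x) (at x within {0..})"
    proof (cases "x = 0")
      case True
      then show ?thesis using right[of 0] by (simp add: at_within_Ici_at_right)
    next
      case False
      then have "(h \<longlongrightarrow> h x) (at x)"
        using x left right by (intro filterlim_split_at) auto
      then show ?thesis by (rule tendsto_within_subset) simp
    qed
  qed
  then show ?thesis using h0 h_eq by (rule that)
qed

lemma piecewise_cont_bounded:
  assumes "piecewise_cont A g l r"
  obtains B where "\<And>x. 0 < x \<Longrightarrow> x \<le> R \<Longrightarrow> x \<notin> A \<Longrightarrow> \<bar>g x\<bar> \<le> B"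
proof -
  obtain h where h: "continuous_on {0..} h" 
    "\<And>x. x > 0 \<Longrightarrow> x \<notin> A \<Longrightarrow> h x = g x - (\<Sum>a\<in>A. (r a - l a) * of_bool (a \<le> x))"
    using piecewise_cont_regularize[OF assms] by blast
  have "compact (h ` {0..R})"
    by (intro compact_continuous_image continuous_on_subset[OF h(1)]) auto
  then have "bounded (h ` {0..R})" by (rule compact_imp_bounded)
  then obtain B where B: "\<forall>x\<in>{0..R}. \<bar>h x\<bar> \<le> B"
    by (auto simp: bounded_iff)
  show ?thesis
  proof
    fix x assume x: "0 < x" "x \<le> R" "x \<notin> A"
    have "\<bar>\<Sum>a\<in>A. (r a - l a) * of_bool (a \<le> x)\<bar> \<le> (\<Sum>a\<in>A. \<bar>(r a - l a) * of_bool (a \<le> x)\<bar>)"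
      by (rule sum_abs)
    also have "\<dots> \<le> (\<Sum>a\<in>A. \<bar>r a - l a\<bar>)"
      by (intro sum_mono) auto
    finally have "\<bar>\<Sum>a\<in>A. (r a - l a) * of_bool (a \<le> x)\<bar> \<le> (\<Sum>a\<in>A. \<bar>r a - l a\<bar>)" .
    moreover have "\<bar>h x\<bar> \<le> B" using B x by auto
    ultimately show "\<bar>g x\<bar> \<le> B + (\<Sum>a\<in>A. \<bar>r a - l a\<bar>)"
      using h(2)[of x] x by linarith
  qed
qed

lemma piecewise_cont_mult_integrable:
  assumes "piecewise_cont A g l r" "continuous_on {0..R} k"
  shows "(\<lambda>x. g x * k x) integrable_on {0..R}"
proof -
  obtain h where h: "continuous_on {0..} h"
    "\<And>x. x > 0 \<Longrightarrow> x \<notin> A \<Longrightarrow> h x = g x - (\<Sum>a\<in>A. (r a - l a) * of_bool (a \<le> x))"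
    using piecewise_cont_regularize[OF assms(1)] by blast
  have A: "finite A" "A \<subseteq> {0<..}" using assms(1) by (auto simp: piecewise_cont_def)
  have *: "(\<lambda>x. if x \<in> {a..} then k x else 0) integrable_on {0..R}" for a
  proof -
    have "k integrable_on {max a 0..R}"
      by (intro integrable_continuous_real continuous_on_subset[OF assms(2)]) auto
    moreover have "{max a 0..R} = {a..} \<inter> {0..R}" by auto
    ultimately show ?thesis by (simp only: integrable_restrict_Int)
  qed
  have "(\<lambda>x. h x * k x) integrable_on {0..R}"
    by (intro integrable_continuous_real continuous_on_mult continuous_on_subset[OF h(1)] assms(2)) auto
  then have "(\<lambda>x. h x * k x + (\<Sum>a\<in>A. (r a - l a) * (if x \<in> {a..} then k x else 0))) integrable_on {0..R}"
    by (intro integrable_add integrable_sum A(1) integrable_on_mult_right *)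
  moreover have "h x * k x + (\<Sum>a\<in>A. (r a - l a) * (if x \<in> {a..} then k x else 0)) = g x * k x"
    if "x \<in> {0..R} - insert 0 A" for x
  proof -
    have *: "(\<Sum>a\<in>A. (r a - l a) * (if x \<in> {a..} then k x else 0)) = (\<Sum>a\<in>A. (r a - l a) * of_bool (a \<le> x)) * k x"
      unfolding sum_distrib_right by (intro sum.cong) auto
    have "h x = g x - (\<Sum>a\<in>A. (r a - l a) * of_bool (a \<le> x))"
      using that by (intro h(2)) auto
    then show ?thesis unfolding * by (simp only: left_diff_distrib diff_add_cancel)
  qed
  ultimately show ?thesis
    using A by (rule_tac integrable_spike_finite[of "insert 0 A"]) auto
qed

text \<open>Instead of summing over the pieces, the fundamental theorem is applied once to a
  corrected product on all of [0, R]; each jump appears as a boundary term.\<close>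

lemma piecewise_integration_by_parts:
  assumes g: "piecewise_cont A g l r" and R: "R > 0" "R \<notin> A" "A \<subseteq> {..R}"
    and g': "\<And>x. x > 0 \<Longrightarrow> x \<notin> A \<Longrightarrow> (g has_real_derivative g' x) (at x)"
    and G: "continuous_on {0..R} G" "\<And>x. 0 < x \<Longrightarrow> x < R \<Longrightarrow> (G has_real_derivative G' x) (at x)"
  shows "((\<lambda>x. g' x * G x + g x * G' x) has_integral
      g R * G R - r 0 * G 0 - (\<Sum>a\<in>A. (r a - l a) * G a)) {0..R}"
proof -
  obtain h where h: "continuous_on {0..} h" "h 0 = r 0"
    "\<And>x. x > 0 \<Longrightarrow> x \<notin> A \<Longrightarrow> h x = g x - (\<Sum>a\<in>A. (r a - l a) * of_bool (a \<le> x))"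
    using piecewise_cont_regularize[OF g] by blast
  have A: "finite A" "A \<subseteq> {0<..}" using g by (auto simp: piecewise_cont_def)
  \<comment> \<open>Off \<open>A\<close>, \<open>F\<close> differs from \<open>g * G\<close> by a locally constant function, and it is continuous.\<close>
  define F where "F x = h x * G x + (\<Sum>a\<in>A. (r a - l a) * (G (max a x) - G a))" for x
  have F: "F x = g x * G x - (\<Sum>a\<in>A. (r a - l a) * of_bool (a \<le> x) * G a)" if "x > 0" "x \<notin> A" for x
  proof -
    have "(\<Sum>a\<in>A. (r a - l a) * (G (max a x) - G a)) =
        (\<Sum>a\<in>A. (r a - l a) * of_bool (a \<le> x) * G x - (r a - l a) * of_bool (a \<le> x) * G a)"
      by (intro sum.cong) (auto simp: max_def algebra_simps)
    then show ?thesis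
      by (simp add: F_def h(3)[OF that] sum_subtractf sum_distrib_right[symmetric] left_diff_distrib)
  qed
  have "((\<lambda>x. g' x * G x + g x * G' x) has_integral F R - F 0) {0..R}"
  proof (rule fundamental_theorem_of_calculus_interior_strong[OF A(1)])
    show "continuous_on {0..R} F"
      unfolding F_def using A R
      by (intro continuous_intros continuous_on_subset[OF h(1)] continuous_on_compose2[OF G(1)]) auto
    fix x assume x: "x \<in> {0<..<R} - A"
    have "open ({0<..} - A)" using A by (auto intro: finite_imp_closed)
    then have ev1: "\<forall>\<^sub>F y in nhds x. y \<in> {0<..} - A"
      using x by (intro eventually_nhds_in_open) auto
    have "\<forall>\<^sub>F y in nhds x. \<forall>a\<in>A. (a \<le> y) = (a \<le> x)"
    proof (intro eventually_ball_finite A(1) ballI)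
      fix a assume "a \<in> A"
      then have "a \<noteq> x" using x by auto
      then have "a < x \<or> x < a" by auto
      then show "\<forall>\<^sub>F y in nhds x. (a \<le> y) = (a \<le> x)"
      proof
        assume "a < x"
        then have "\<forall>\<^sub>F y in nhds x. y \<in> {a<..}" by (intro eventually_nhds_in_open) auto
        then show ?thesis using \<open>a < x\<close> by (auto elim: eventually_mono)
      next
        assume "x < a"
        then have "\<forall>\<^sub>F y in nhds x. y \<in> {..<a}" by (intro eventually_nhds_in_open) auto
        then show ?thesis using \<open>x < a\<close> by (auto elim: eventually_mono)
      qed
    qed
    with ev1 have "\<forall>\<^sub>F y in nhds x. F y = g y * G y - (\<Sum>a\<in>A. (r a - l a) * of_bool (a \<le> x) * G a)"
      by eventually_elim (auto simp: F intro!: sum.cong)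
    moreover have "((\<lambda>y. g y * G y - (\<Sum>a\<in>A. (r a - l a) * of_bool (a \<le> x) * G a)) has_real_derivative g' x * G x + g x * G' x) (at x)"
      using x by (auto intro!: derivative_eq_intros g' G)
    ultimately have "(F has_real_derivative g' x * G x + g x * G' x) (at x)"
      by (subst DERIV_cong_ev[OF refl _ refl]) auto
    then show "(F has_vector_derivative g' x * G x + g x * G' x) (at x)"
      by (simp add: has_real_derivative_iff_has_vector_derivative)
  qed (use R in auto)
  \<comment> \<open>At \<open>R\<close> all steps are active and at 0 none is, so the difference
    contains the full sum over the jumps.\<close>
  moreover have "F R = g R * G R - (\<Sum>a\<in>A. (r a - l a) * G a)"
    using R by (subst F) (auto intro!: sum.cong)
  moreover have "F 0 = r 0 * G 0"
    using A by (auto simp: F_def h max_def intro!: sum.neutral)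
  ultimately show ?thesis by (simp add: algebra_simps)
qed

section \<open>Trigonometric sums\<close>

lemma tendsto_shift_at_top:
  fixes F :: "real \<Rightarrow> 'a :: topological_space"
  assumes "(F \<longlongrightarrow> L) at_top"
  shows "((\<lambda>M. F (M + h)) \<longlongrightarrow> L) at_top"
proof -
  have "filterlim (\<lambda>M. h + M) at_top (at_top :: real filter)"
    by (rule filterlim_tendsto_add_at_top[OF tendsto_const filterlim_ident])
  from filterlim_compose[OF assms this] show ?thesis by (simp add: add.commute)
qed

text \<open>Induction on the number of frequencies: a combination of shifts preserves convergence
  and deletes one of them. Positivity excludes the frequency 0, which converges, and pairs of
  opposite frequencies, whose real parts could cancel.\<close>

lemma trig_sum_tendsto_imp_coeffs_zero:
  fixes C :: "real \<Rightarrow> complex"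
  assumes "finite A" "A \<subseteq> {0<..}" "((\<lambda>M. Re (\<Sum>a\<in>A. C a * cis (a * M))) \<longlongrightarrow> L) at_top"
  shows "\<forall>a\<in>A. C a = 0"
  using assms
proof (induction A arbitrary: C L rule: finite_induct)
  case (insert b A)
  define S where "S M = Re (\<Sum>a\<in>insert b A. C a * cis (a * M))" for M
  have S: "(S \<longlongrightarrow> L) at_top" using insert.prems by (simp add: S_def[abs_def])
  \<comment> \<open>A positive bound for all frequencies, so that every a h lies in [0, 1], inside
    [0, pi] where cosine is injective.\<close>
  define s where "s = 1 + (\<Sum>a\<in>insert b A. a)"
  have nonneg: "0 \<le> a" if "a \<in> insert b A" for a
    using that insert.prems(1) by auto
  have s_pos: "s > 0"
    unfolding s_def using nonneg by (intro add_pos_nonneg sum_nonneg) auto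
  define h where "h = 1 / s"
  have h: "0 \<le> a * h" "a * h \<le> pi" if "a \<in> insert b A" for a
  proof -
    have "a \<le> (\<Sum>a\<in>insert b A. a)"
      using that insert.hyps nonneg by (intro member_le_sum) auto
    then have "a * h \<le> 1" using s_pos by (simp add: h_def s_def field_simps)
    then show "a * h \<le> pi" using pi_gt3 by linarith
    show "0 \<le> a * h" using nonneg[OF that] s_pos by (simp add: h_def)
  qed
  \<comment> \<open>This second difference multiplies the frequency \<open>a\<close> by \<open>2 (cos (a h) - cos (b h))\<close>: it removes
    \<open>b\<close>, and no other frequency because \<open>h\<close> is small.\<close>
  define T where "T M = S (M + h) + S (M + (- h)) - 2 * cos (b * h) * S M" for M
  have T: "(T \<longlongrightarrow> L + L - 2 * cos (b * h) * L) at_top"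
    unfolding T_def by (intro tendsto_intros tendsto_shift_at_top S)
  have T_eq: "T M = Re (\<Sum>a\<in>A. (C a * of_real (2 * (cos (a * h) - cos (b * h)))) * cis (a * M))" for M
  proof -
    have Re_comb: "Re (X + Y - of_real r * Z) = Re X + Re Y - r * Re Z" for X Y Z r
      by simp
    have *: "C a * cis (a * (M + h)) + C a * cis (a * (M + (- h))) - of_real (2 * cos (b * h)) * (C a * cis (a * M))
      = (C a * of_real (2 * (cos (a * h) - cos (b * h)))) * cis (a * M)" for a
    proof -
      have "cis (a * (M + h)) = cis (a * M) * cis (a * h)" "cis (a * (M + (- h))) = cis (a * M) * cis (- (a * h))"
        by (simp_all add: cis_mult algebra_simps)
      moreover have "cis (a * h) + cis (- (a * h)) = of_real (2 * cos (a * h))"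
        by (simp add: complex_eq_iff)
      moreover have "c * (z * p) + c * (z * q) - d * (c * z) = c * (p + q - d) * z" for c z p q d :: complex
        by (simp add: algebra_simps)
      ultimately show ?thesis
        by (simp add: right_diff_distrib)
    qed
    have "T M = Re ((\<Sum>a\<in>insert b A. C a * cis (a * (M + h))) + (\<Sum>a\<in>insert b A. C a * cis (a * (M + (- h))))
      - of_real (2 * cos (b * h)) * (\<Sum>a\<in>insert b A. C a * cis (a * M)))"
      by (simp only: T_def S_def Re_comb)
    also have "\<dots> = Re (\<Sum>a\<in>insert b A. C a * cis (a * (M + h)) + C a * cis (a * (M + (- h)))
      - of_real (2 * cos (b * h)) * (C a * cis (a * M)))"
      by (simp only: sum.distrib sum_subtractf sum_distrib_left)
    also have "\<dots> = Re (\<Sum>a\<in>insert b A. (C a * of_real (2 * (cos (a * h) - cos (b * h)))) * cis (a * M))"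
      unfolding * ..
    also have "\<dots> = Re (\<Sum>a\<in>A. (C a * of_real (2 * (cos (a * h) - cos (b * h)))) * cis (a * M))"
      using insert.hyps by simp
    finally show ?thesis .
  qed
  have "((\<lambda>M. Re (\<Sum>a\<in>A. (C a * of_real (2 * (cos (a * h) - cos (b * h)))) * cis (a * M)))
      \<longlongrightarrow> L + L - 2 * cos (b * h) * L) at_top"
    using T unfolding T_eq[abs_def] .
  from insert.IH[OF _ this] insert.prems(1)
  have IH: "\<forall>a\<in>A. C a * of_real (2 * (cos (a * h) - cos (b * h))) = 0" by auto
  have A0: "C a = 0" if "a \<in> A" for a
  proof -
    have "a * h \<noteq> b * h" using that insert.hyps s_pos by (auto simp: h_def)
    then have "cos (a * h) \<noteq> cos (b * h)"
      using cos_inj_pi[OF h h, of a b] that by auto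
    then show ?thesis using IH that by auto
  qed
  have b: "b > 0" using insert.prems by auto
  have S_eq: "S M = Re (C b * cis (b * M))" for M
    using insert.hyps A0 by (simp add: S_def)
  have lim: "((\<lambda>M. Re (C b * cis (b * M))) \<longlongrightarrow> L) at_top"
    using S unfolding S_eq[abs_def] .
  \<comment> \<open>Only frequency \<open>b\<close> is left. A shift by half a period reverses the
    sign, so L = -L.\<close>
  have neg: "C b * cis (b * (M + pi / b)) = - (C b * cis (b * M))" for M
    using b by (simp add: distrib_left flip: cis_mult)
  have "((\<lambda>M. - Re (C b * cis (b * M))) \<longlongrightarrow> L) at_top"
    using tendsto_shift_at_top[OF lim, of "pi / b"] unfolding neg uminus_complex.sel .
  from tendsto_unique[OF _ this tendsto_minus[OF lim]] have "L = 0" by simp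
  with lim have Re: "((\<lambda>M. Re (C b * cis (b * M))) \<longlongrightarrow> 0) at_top" by simp
  \<comment> \<open>A quarter period turns the real part into minus the imaginary part. Both then
    tend to 0, while the modulus is constantly norm (C b).\<close>
  have rot: "C b * cis (b * (M + pi / (2 * b))) = \<i> * (C b * cis (b * M))" for M
    using b by (simp add: distrib_left mult_ac flip: cis_mult)
  have "((\<lambda>M. - Im (C b * cis (b * M))) \<longlongrightarrow> 0) at_top"
    using tendsto_shift_at_top[OF Re, of "pi / (2 * b)"] unfolding rot Re_i_times .
  from tendsto_minus[OF this] have "((\<lambda>M. Im (C b * cis (b * M))) \<longlongrightarrow> 0) at_top"
    by (simp only: minus_minus minus_zero)
  with Re have "((\<lambda>M. C b * cis (b * M)) \<longlongrightarrow> 0) at_top"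
    by (simp only: tendsto_complex_iff zero_complex.sel)
  then have "((\<lambda>M::real. norm (C b)) \<longlongrightarrow> 0) at_top"
    by (drule_tac tendsto_norm_zero) (simp add: norm_mult)
  then have "C b = 0" by (simp add: tendsto_const_iff)
  with A0 show ?case by auto
qed auto

section \<open>Asymptotics of the spherical partial sums\<close>

lemma piecewise_Ck_imp_piecewise_cont:
  assumes "piecewise_Ck k A g" "j \<le> k"
  shows "piecewise_cont A ((deriv ^^ j) g) (left_limit ((deriv ^^ j) g)) (right_limit ((deriv ^^ j) g))"
proof -
  have left: "(h \<longlongrightarrow> left_limit h a) (at_left a)" if "\<exists>l. (h \<longlongrightarrow> l) (at_left a)" for h a
    using that tendsto_Lim[of "at_left a" h] by (auto simp: left_limit_def)
  have right: "(h \<longlongrightarrow> right_limit h a) (at_right a)" if "\<exists>l. (h \<longlongrightarrow> l) (at_right a)" for h a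
    using that tendsto_Lim[of "at_right a" h] by (auto simp: right_limit_def)
  show ?thesis
    unfolding piecewise_cont_def
  proof (intro conjI ballI left right)
    show "finite A" "A \<subseteq> {0<..}" "continuous_on ({0<..} - A) ((deriv ^^ j) g)"
      using assms by (auto simp: piecewise_Ck_def Ck_on_def)
    show "\<exists>l. ((deriv ^^ j) g \<longlongrightarrow> l) (at_left a)" if "a \<in> A" for a
      using assms that by (simp add: piecewise_Ck_def)
    show "\<exists>l. ((deriv ^^ j) g \<longlongrightarrow> l) (at_right a)" if "a \<in> insert 0 A" for a
      using assms that unfolding piecewise_Ck_def by blast
  qed
qed

lemma piecewise_Ck_has_deriv:
  assumes "piecewise_Ck k A g" "j < k" "x > 0" "x \<notin> A"
  shows "((deriv ^^ j) g has_real_derivative (deriv ^^ Suc j) g x) (at x)"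
proof -
  have "(deriv ^^ j) g differentiable (at x within {0<..} - A)" "open ({0<..} - A)"
    using assms by (auto simp: piecewise_Ck_def Ck_on_def differentiable_on_def)
  then have "(deriv ^^ j) g differentiable (at x)"
    using assms at_within_open[of x "{0<..} - A"] by simp
  then obtain D where "((deriv ^^ j) g has_real_derivative D) (at x)"
    by (auto simp: real_differentiable_def)
  then show ?thesis using DERIV_imp_deriv by fastforce
qed

text \<open>The constant must be independent of \<open>M\<close>. All error terms contain the
  primitive of J_0(M x), which is C / M uniformly in x, because rescaling a bounded primitive of J_0
  brings out 1 / M.\<close>

lemma bessel1_integral_expansion:
  assumes g: "piecewise_Ck 2 A g" and R0: "\<And>r. r \<ge> R0 \<Longrightarrow> g r = 0"
  obtains K where "\<And>M. M > 0 \<Longrightarrow>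
      integrable lborel (\<lambda>r. indicator ({0<..} - A) r * (g r * (M * bessel1 (M * r)))) \<Longrightarrow>
      \<bar>(LINT r|lborel. indicator ({0<..} - A) r * (g r * (M * bessel1 (M * r))))
        - right_limit g 0 - (\<Sum>a\<in>A. jump g a * bessel0 (M * a))\<bar> \<le> K / M"
proof -
  define g1 g2 where "g1 = deriv g" and "g2 = deriv (deriv g)"
  define l0 r0 l1 r1 where "l0 = left_limit g" and "r0 = right_limit g" and "l1 = left_limit g1" and "r1 = right_limit g1"
  have pc0: "piecewise_cont A g l0 r0"
    using piecewise_Ck_imp_piecewise_cont[OF g, of 0] by (simp add: l0_def r0_def)
  have pc1: "piecewise_cont A g1 l1 r1"
    using piecewise_Ck_imp_piecewise_cont[OF g, of 1] by (simp add: l1_def r1_def g1_def)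
  have pc2: "piecewise_cont A g2 (left_limit g2) (right_limit g2)"
    using piecewise_Ck_imp_piecewise_cont[OF g, of 2] by (simp add: g2_def numeral_2_eq_2)
  have d0: "(g has_real_derivative g1 x) (at x)" if "x > 0" "x \<notin> A" for x
    using piecewise_Ck_has_deriv[OF g, of 0] that by (simp add: g1_def)
  have d1: "(g1 has_real_derivative g2 x) (at x)" if "x > 0" "x \<notin> A" for x
    using piecewise_Ck_has_deriv[OF g, of 1] that by (simp add: g1_def g2_def)
  have A: "finite A" "A \<subseteq> {0<..}" using pc0 by (auto simp: piecewise_cont_def)
  \<comment> \<open>Beyond all break points and the vanishing radius; the 1 keeps \<open>R\<close>
    itself off \<open>A\<close>.\<close>
  define R where "R = 1 + max 0 (max R0 (Max (insert 0 A)))"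
  have "a < R" if "a \<in> A" for a
  proof -
    have "a \<le> Max (insert 0 A)" using A that by (intro Max_ge) auto
    then show ?thesis unfolding R_def by linarith
  qed
  then have RA: "R \<notin> A" "A \<subseteq> {..R}" by force+
  have R: "R > 0" "R0 \<le> R" by (auto simp: R_def)
  obtain G C where G: "\<And>u. u \<ge> 0 \<Longrightarrow> (G has_real_derivative bessel0 u) (at u)"
    and C: "\<And>u. u \<ge> 0 \<Longrightarrow> \<bar>G u\<bar> \<le> C"
    using integral_bessel0 by blast
  obtain B where B: "\<And>x. 0 < x \<Longrightarrow> x \<le> R \<Longrightarrow> x \<notin> A \<Longrightarrow> \<bar>g2 x\<bar> \<le> B"
    using piecewise_cont_bounded[OF pc2] by blast
  have "C \<ge> 0" using C[of 0] by linarith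
  define K where "K = \<bar>g1 R\<bar> * C + \<bar>r1 0\<bar> * C + (\<Sum>a\<in>A. \<bar>r1 a - l1 a\<bar> * C) + \<bar>B\<bar> * C * R"
  show ?thesis
  proof (rule that[of K])
    fix M :: real assume M: "M > 0"
    assume int: "integrable lborel (\<lambda>r. indicator ({0<..} - A) r * (g r * (M * bessel1 (M * r))))"
      (is "integrable _ ?F")
    let ?S = "\<Sum>a\<in>A. (r0 a - l0 a) * bessel0 (M * a)"
    define H where "H x = G (M * x) / M" for x
    have H_bound: "\<bar>H x\<bar> \<le> C / M" if "x \<ge> 0" for x
      using C[of "M * x"] M that by (simp add: H_def divide_right_mono)
    have H_deriv: "(H has_real_derivative bessel0 (M * x)) (at x)" if "x \<ge> 0" for x
    proof -
      have "((\<lambda>x. G (M * x)) has_real_derivative bessel0 (M * x) * M) (at x)"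
        using M that by (intro DERIV_chain2[OF G]) (auto intro!: derivative_eq_intros)
      from DERIV_cdivide[OF this, of M] show ?thesis using M by (simp add: H_def[abs_def])
    qed
    have H_cont: "continuous_on {0..R} H"
      by (intro continuous_at_imp_continuous_on ballI DERIV_isCont[OF H_deriv]) auto
    have b0: "((\<lambda>x. bessel0 (M * x)) has_real_derivative - M * bessel1 (M * x)) (at x)" for x
    proof -
      have "((\<lambda>x. bessel0 (M * x)) has_real_derivative - bessel1 (M * x) * M) (at x)"
        by (rule DERIV_chain2[OF bessel0_deriv]) (auto intro!: derivative_eq_intros)
      then show ?thesis by (simp add: mult.commute)
    qed
    have ibp0: "((\<lambda>x. g1 x * bessel0 (M * x) + g x * (- M * bessel1 (M * x))) has_integral
        g R * bessel0 (M * R) - r0 0 * bessel0 (M * 0) - ?S) {0..R}"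
      using RA R by (intro piecewise_integration_by_parts[OF pc0] d0 b0) (auto intro!: continuous_intros)
    \<comment> \<open>Boundary and jump terms of the second integration by parts; with
      \<open>E2\<close> for the integral against \<open>g2\<close>, the integral of
      \<open>g1 x * bessel0 (M * x)\<close> is E1 - E2.\<close>
    define E1 where "E1 = g1 R * H R - r1 0 * H 0 - (\<Sum>a\<in>A. (r1 a - l1 a) * H a)"
    have ibp1: "((\<lambda>x. g2 x * H x + g1 x * bessel0 (M * x)) has_integral E1) {0..R}"
      unfolding E1_def using RA R
      by (intro piecewise_integration_by_parts[OF pc1] d1 H_cont H_deriv) auto
    obtain E2 where E2: "((\<lambda>x. g2 x * H x) has_integral E2) {0..R}"
      using piecewise_cont_mult_integrable[OF pc2 H_cont] by (auto simp: integrable_on_def)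
    have "norm E2 \<le> (\<bar>B\<bar> * (C / M)) * measure lborel (cbox 0 R)"
    proof (rule has_integral_bound_spike_finite)
      show "finite (insert 0 A)" using A by simp
      show "((\<lambda>x. g2 x * H x) has_integral E2) (cbox 0 R)" using E2 by simp
      show "0 \<le> \<bar>B\<bar> * (C / M)" using \<open>C \<ge> 0\<close> M by simp
      fix x assume "x \<in> cbox 0 R - insert 0 A"
      then have "\<bar>g2 x\<bar> \<le> \<bar>B\<bar>" "\<bar>H x\<bar> \<le> C / M" using B[of x] H_bound[of x] by auto
      then show "norm (g2 x * H x) \<le> \<bar>B\<bar> * (C / M)"
        by (simp only: real_norm_def abs_mult) (intro mult_mono, auto)
    qed
    then have E2_bound: "\<bar>E2\<bar> \<le> \<bar>B\<bar> * C * R / M" using R by simp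
    have "\<bar>E1\<bar> \<le> \<bar>g1 R\<bar> * (C / M) + \<bar>r1 0\<bar> * (C / M) + (\<Sum>a\<in>A. \<bar>r1 a - l1 a\<bar> * (C / M))"
    proof -
      have "\<bar>g1 R * H R\<bar> \<le> \<bar>g1 R\<bar> * (C / M)" "\<bar>r1 0 * H 0\<bar> \<le> \<bar>r1 0\<bar> * (C / M)"
        unfolding abs_mult using R by (intro mult_left_mono H_bound; simp)+
      moreover have "\<bar>\<Sum>a\<in>A. (r1 a - l1 a) * H a\<bar> \<le> (\<Sum>a\<in>A. \<bar>r1 a - l1 a\<bar> * (C / M))"
      proof (rule order_trans[OF sum_abs sum_mono])
        fix a assume "a \<in> A"
        then have "\<bar>H a\<bar> \<le> C / M" using A(2) by (intro H_bound) auto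
        then show "\<bar>(r1 a - l1 a) * H a\<bar> \<le> \<bar>r1 a - l1 a\<bar> * (C / M)"
          unfolding abs_mult by (rule mult_left_mono) simp
      qed
      ultimately show ?thesis unfolding E1_def by linarith
    qed
    also have "\<dots> = (\<bar>g1 R\<bar> * C + \<bar>r1 0\<bar> * C + (\<Sum>a\<in>A. \<bar>r1 a - l1 a\<bar> * C)) / M"
      by (simp add: add_divide_distrib sum_divide_distrib)
    finally have E_bound: "\<bar>E1 - E2\<bar> \<le> K / M"
      using E2_bound unfolding K_def add_divide_distrib by linarith
    have "((\<lambda>x. g1 x * bessel0 (M * x)) has_integral E1 - E2) {0..R}"
      using has_integral_diff[OF ibp1 E2] by simp
    \<comment> \<open>The boundary term at \<open>R\<close> drops out since g R = 0, and J_0(0) = 1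
      leaves \<open>r0 0\<close>.\<close>
    from has_integral_diff[OF this ibp0]
    have "((\<lambda>x. g x * (M * bessel1 (M * x))) has_integral E1 - E2 + r0 0 + ?S) {0..R}"
      using R0[OF R(2)] by (simp add: bessel0_0 algebra_simps)
    then have "((\<lambda>x. if x \<in> {0..R} then g x * (M * bessel1 (M * x)) else 0) has_integral E1 - E2 + r0 0 + ?S) UNIV"
      by (simp only: has_integral_restrict_UNIV)
    \<comment> \<open>The integrand vanishes beyond \<open>R\<close>, so the two functions differ at
      most on the finite set \<open>insert 0 A\<close>.\<close>
    then have "(?F has_integral E1 - E2 + r0 0 + ?S) UNIV"
      by (rule has_integral_spike_finite[of "insert 0 A", rotated 2])
         (use A R0 R in \<open>auto simp: indicator_def\<close>)
    moreover have "(?F has_integral integral\<^sup>L lborel ?F) UNIV"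
      by (rule has_integral_integral_real[OF int])
    ultimately have "E1 - E2 + r0 0 + ?S = integral\<^sup>L lborel ?F"
      by (rule has_integral_unique)
    then show "\<bar>integral\<^sup>L lborel ?F - right_limit g 0 - (\<Sum>a\<in>A. jump g a * bessel0 (M * a))\<bar> \<le> K / M"
      using E_bound unfolding r0_def l0_def jump_def by linarith
  qed
qed

text \<open>Rescaling with u = M a. One nonzero \<open>c\<close> serves all radii, so the
  coefficient of a frequency vanishes only if the jump there does.\<close>

lemma sqrt_bessel0_asymptotics:
  obtains c :: complex where "c \<noteq> 0"
    and "\<And>a. a > 0 \<Longrightarrow> ((\<lambda>M. sqrt M * bessel0 (M * a) - Re (c / sqrt a * cis (a * M))) \<longlongrightarrow> 0) at_top"
proof -
  obtain c K where c: "c \<noteq> 0"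
    and K: "\<And>u. u \<ge> 1 \<Longrightarrow> \<bar>sqrt u * bessel0 u - Re (c * cis u)\<bar> \<le> K / u"
    using bessel0_asymptotics by blast
  have "((\<lambda>M. sqrt M * bessel0 (M * a) - Re (c / sqrt a * cis (a * M))) \<longlongrightarrow> 0) at_top" if a: "a > 0" for a
  proof (rule Lim_null_comparison)
    show "((\<lambda>M. (K / a / sqrt a) / M) \<longlongrightarrow> 0) at_top"
      by (intro tendsto_divide_0[OF tendsto_const] filterlim_at_top_imp_at_infinity filterlim_ident)
    have "\<forall>\<^sub>F M in at_top. M \<ge> 1 / a" by (rule eventually_ge_at_top)
    then show "\<forall>\<^sub>F M in at_top. norm (sqrt M * bessel0 (M * a) - Re (c / sqrt a * cis (a * M))) \<le> (K / a / sqrt a) / M"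
    proof eventually_elim
      case (elim M)
      have M: "M > 0" using elim a by (intro less_le_trans[OF _ elim]) auto
      have "1 \<le> M * a" using elim a by (simp add: field_simps)
      from K[OF this] have "\<bar>sqrt (M * a) * bessel0 (M * a) - Re (c * cis (M * a))\<bar> / sqrt a \<le> K / (M * a) / sqrt a"
        using a by (intro divide_right_mono) auto
      also have "\<bar>sqrt (M * a) * bessel0 (M * a) - Re (c * cis (M * a))\<bar> / sqrt a =
          \<bar>(sqrt (M * a) * bessel0 (M * a) - Re (c * cis (M * a))) / sqrt a\<bar>"
        using a by simp
      also have "(sqrt (M * a) * bessel0 (M * a) - Re (c * cis (M * a))) / sqrt a =
          sqrt M * bessel0 (M * a) - Re (c / sqrt a * cis (a * M))"
      proof -
        have "c / sqrt a * cis (a * M) = (c * cis (M * a)) / sqrt a" by (simp add: mult.commute)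
        then have "Re (c / sqrt a * cis (a * M)) = Re (c * cis (M * a)) / sqrt a" by (simp only: Re_divide_of_real)
        then show ?thesis using a by (simp add: diff_divide_distrib real_sqrt_mult)
      qed
      finally show ?case by (simp add: mult_ac)
    qed
  qed
  with c show ?thesis by (rule that)
qed

theorem mainTheorem2:
  fixes f :: "real \<times> real \<Rightarrow> real" and x :: "real \<times> real" and A :: "real set"
  assumes "integrable lebesgue f"
    and "piecewise_smooth_wrt 2 A f x"
  shows "((\<forall>a\<in>A. jump (spherical_mean f x) a = 0) \<longrightarrow>
        (\<lambda>M. spherical_partial_sum f M x - complex_of_real (right_limit (spherical_mean f x) 0))
          \<in> O[at_top](\<lambda>M. complex_of_real (1 / M))) \<and>
      ((\<exists>a\<in>A. jump (spherical_mean f x) a \<noteq> 0) \<longrightarrow>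
        (let D = (\<lambda>M. ereal (sqrt M *
               (Re (spherical_partial_sum f M x) - right_limit (spherical_mean f x) 0)))
         in - \<infinity> < Liminf at_top D \<and> Liminf at_top D < Limsup at_top D \<and> Limsup at_top D < \<infinity>))"
proof -
  define g where "g = spherical_mean f x"
  have g: "piecewise_Ck 2 A g" using assms(2) by (simp add: piecewise_smooth_wrt_def g_def)
  obtain R0 where R0: "\<And>r. r \<ge> R0 \<Longrightarrow> g r = 0"
    using assms(2) by (auto simp: piecewise_smooth_wrt_def g_def)
  have A: "finite A" "A \<subseteq> {0<..}" using g by (auto simp: piecewise_Ck_def)
  have exists: "spherical_mean_exists f x r" if "r \<in> {0<..} - A" for r
    using assms(2) that by (auto simp: piecewise_smooth_wrt_def)
  have cont: "continuous_on ({0<..} - A) (spherical_mean f x)"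
    using piecewise_Ck_imp_piecewise_cont[OF g, of 0] by (simp add: piecewise_cont_def g_def)
  note mean = spherical_partial_sum_eq_bessel_integral[OF assms(1) _ A(1) exists cont]
  define \<Delta> where "\<Delta> M = Re (spherical_partial_sum f M x) - right_limit g 0" for M
  obtain K where expansion: "\<And>M. M > 0 \<Longrightarrow>
      integrable lborel (\<lambda>r. indicator ({0<..} - A) r * (g r * (M * bessel1 (M * r)))) \<Longrightarrow>
      \<bar>(LINT r|lborel. indicator ({0<..} - A) r * (g r * (M * bessel1 (M * r))))
        - right_limit g 0 - (\<Sum>a\<in>A. jump g a * bessel0 (M * a))\<bar> \<le> K / M"
    using bessel1_integral_expansion[OF g R0] by blast
  have K: "\<bar>\<Delta> M - (\<Sum>a\<in>A. jump g a * bessel0 (M * a))\<bar> \<le> K / M" if "M > 0" for M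
    using expansion[OF that mean(1)[OF that, folded g_def]]
    by (simp only: \<Delta>_def mean(2)[OF that, folded g_def])
  show ?thesis
    unfolding Let_def g_def[symmetric] \<Delta>_def[symmetric]
  proof (intro conjI impI)
    assume "\<forall>a\<in>A. jump g a = 0"
    with K have bound: "\<bar>\<Delta> M\<bar> \<le> K / M" if "M > 0" for M using that by simp
    have "\<forall>\<^sub>F M in at_top. norm (spherical_partial_sum f M x - complex_of_real (right_limit g 0)) \<le> K * norm (complex_of_real (1 / M))"
      using eventually_gt_at_top[of 0]
    proof eventually_elim
      case (elim M)
      \<comment> \<open>Since the partial sum is real, its complex error has modulus |\<Delta>
        M|.\<close>
      have "spherical_partial_sum f M x - complex_of_real (right_limit g 0) = complex_of_real (\<Delta> M)"
        using spherical_partial_sum_real[of f M x] by (simp add: \<Delta>_def)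
      then show ?case using bound[OF elim] elim by (simp only: norm_of_real) simp
    qed
    then show "(\<lambda>M. spherical_partial_sum f M x - complex_of_real (right_limit g 0)) \<in> O[at_top](\<lambda>M. complex_of_real (1 / M))"
      by (rule bigoI)
  next
    assume "\<exists>a\<in>A. jump g a \<noteq> 0"
    then obtain b where b: "b \<in> A" "jump g b \<noteq> 0" by blast
    let ?D = "\<lambda>M. ereal (sqrt M * \<Delta> M)"
    obtain c :: complex where c: "c \<noteq> 0"
      and lim: "\<And>a. a > 0 \<Longrightarrow> ((\<lambda>M. sqrt M * bessel0 (M * a) - Re (c / sqrt a * cis (a * M))) \<longlongrightarrow> 0) at_top"
      using sqrt_bessel0_asymptotics by blast
    define d where "d a = of_real (jump g a) * (c / sqrt a)" for a
    define S where "S M = Re (\<Sum>a\<in>A. d a * cis (a * M))" for M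
    \<comment> \<open>The O(1/M) remainder stays negligible after multiplication by sqrt M.\<close>
    have "((\<lambda>M. sqrt M * (\<Delta> M - (\<Sum>a\<in>A. jump g a * bessel0 (M * a)))) \<longlongrightarrow> 0) at_top"
    proof (rule Lim_null_comparison)
      show "((\<lambda>M. K / sqrt M) \<longlongrightarrow> 0) at_top"
        by (intro tendsto_divide_0[OF tendsto_const] filterlim_at_top_imp_at_infinity sqrt_at_top)
      show "\<forall>\<^sub>F M in at_top. norm (sqrt M * (\<Delta> M - (\<Sum>a\<in>A. jump g a * bessel0 (M * a)))) \<le> K / sqrt M"
        using eventually_gt_at_top[of 0]
      proof eventually_elim
        case (elim M)
        have "norm (sqrt M * (\<Delta> M - (\<Sum>a\<in>A. jump g a * bessel0 (M * a)))) \<le> sqrt M * (K / M)"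
          using mult_left_mono[OF K[OF elim], of "sqrt M"] elim by (simp add: abs_mult)
        also have "\<dots> = K / sqrt M"
          using elim by (simp add: field_simps)
        finally show ?case .
      qed
    qed
    moreover have "((\<lambda>M. \<Sum>a\<in>A. jump g a * (sqrt M * bessel0 (M * a) - Re (c / sqrt a * cis (a * M)))) \<longlongrightarrow> (\<Sum>a\<in>A. jump g a * 0)) at_top"
      using A(2) by (intro tendsto_intros lim) auto
    ultimately have "((\<lambda>M. sqrt M * (\<Delta> M - (\<Sum>a\<in>A. jump g a * bessel0 (M * a))) +
        (\<Sum>a\<in>A. jump g a * (sqrt M * bessel0 (M * a) - Re (c / sqrt a * cis (a * M))))) \<longlongrightarrow> 0 + (\<Sum>a\<in>A. jump g a * 0)) at_top"
      by (rule tendsto_add)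
    moreover have "sqrt M * (\<Delta> M - (\<Sum>a\<in>A. jump g a * bessel0 (M * a))) +
        (\<Sum>a\<in>A. jump g a * (sqrt M * bessel0 (M * a) - Re (c / sqrt a * cis (a * M)))) = sqrt M * \<Delta> M - S M" for M
    proof -
      have "S M = (\<Sum>a\<in>A. jump g a * Re (c / sqrt a * cis (a * M)))"
        unfolding S_def d_def Re_sum mult.assoc by (intro sum.cong refl) simp
      moreover have "sqrt M * (\<Sum>a\<in>A. jump g a * bessel0 (M * a)) = (\<Sum>a\<in>A. jump g a * (sqrt M * bessel0 (M * a)))"
        unfolding sum_distrib_left by (intro sum.cong refl) simp
      ultimately show ?thesis
        by (simp only: right_diff_distrib sum_subtractf)
    qed
    ultimately have DS: "((\<lambda>M. sqrt M * \<Delta> M - S M) \<longlongrightarrow> 0) at_top" by simp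
    \<comment> \<open>The extra 1 absorbs the eventual distance between
      \<open>sqrt M * \<Delta> M\<close> and \<open>S M\<close>.\<close>
    define C where "C = (\<Sum>a\<in>A. norm (d a)) + 1"
    have S_bound: "\<bar>S M\<bar> \<le> C - 1" for M
    proof -
      have "\<bar>S M\<bar> \<le> norm (\<Sum>a\<in>A. d a * cis (a * M))" unfolding S_def by (rule abs_Re_le_cmod)
      also have "\<dots> \<le> (\<Sum>a\<in>A. norm (d a * cis (a * M)))" by (rule norm_sum)
      finally show ?thesis by (simp add: C_def norm_mult)
    qed
    have "\<forall>\<^sub>F M in at_top. dist (sqrt M * \<Delta> M - S M) 0 < 1"
      using DS by (rule tendstoD) simp
    then have ev: "\<forall>\<^sub>F M in at_top. \<bar>sqrt M * \<Delta> M\<bar> \<le> C"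
    proof eventually_elim
      case (elim M)
      then show ?case using S_bound[of M] by (simp add: dist_real_def)
    qed
    have "ereal (- C) \<le> Liminf at_top ?D"
      by (rule Liminf_bounded) (use ev in \<open>auto elim!: eventually_mono\<close>)
    then show Liminf: "- \<infinity> < Liminf at_top ?D"
      by (rule less_le_trans[rotated]) simp
    have "Limsup at_top ?D \<le> ereal C"
      by (rule Limsup_bounded) (use ev in \<open>auto elim!: eventually_mono\<close>)
    then show Limsup: "Limsup at_top ?D < \<infinity>"
      by (rule le_less_trans) simp
    have le: "Liminf at_top ?D \<le> Limsup at_top ?D"
      by (rule Liminf_le_Limsup) simp
    \<comment> \<open>Equality would be at a real number, both sides being finite, and would force
      \<open>S\<close> to converge; then d b = 0, contradicting the nonzero jump at \<open>b\<close>
      and c \<noteq> 0.\<close>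
    have "Liminf at_top ?D \<noteq> Limsup at_top ?D"
    proof
      assume eq: "Liminf at_top ?D = Limsup at_top ?D"
      then obtain L where L: "Liminf at_top ?D = ereal L"
        using Liminf Limsup by (cases "Limsup at_top ?D") auto
      have "(?D \<longlongrightarrow> ereal L) at_top"
        using L eq by (intro Liminf_eq_Limsup) auto
      then have "((\<lambda>M. sqrt M * \<Delta> M) \<longlongrightarrow> L) at_top" by simp
      from tendsto_diff[OF this DS] have "(S \<longlongrightarrow> L) at_top" by simp
      then have "\<forall>a\<in>A. d a = 0"
        unfolding S_def[abs_def] by (rule trig_sum_tendsto_imp_coeffs_zero[OF A])
      with b c A(2) show False by (auto simp: d_def)
    qed
    with le show "Liminf at_top ?D < Limsup at_top ?D" by simp
  qed
qed

end
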